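(* Let $T$ be a spider with bipartition $X$ and $Y$, and let $t=\max\{|X|,|Y|\}$. Then every $2$-connected bipartite graph $G$ with minimum degree $\delta(G)\geq t+2$ contains a subgraph $T'$ that is a spider isomorphic to $T$ and such that $G-V(T')$ is still $2$-connected.
   Context: All graphs are finite and undirected, without loops or multiple edges. $\delta(G)$ is the minimum degree of $G$. For $S\subseteq V(G)$, $G-S$ is the graph obtained from $G$ by deleting the vertices of $S$ (and all incident edges). The connectivity $\kappa(G)$ is the minimum size of a vertex set $S$ such that $G-S$ is disconnected or has only one vertex; $G$ is $k$-connected if $\kappa(G)\geq k$. A spider is a tree with at most one vertex of degree more than $2$. The bipartition $X,Y$ of a tree is its partition into two independent sets. *)

theory Defs
  imports "Graph_Theory.Graph_Theory"
begin

text \<open>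
  A finite simple undirected graph is the library's \<open>graph\<close>: a finite symmetric digraph without
  loops and parallel arcs. Each undirected edge is a pair of opposite arcs, so the degree of a
  vertex is its \<open>out_degree\<close>, subgraphs have to be required to be a \<open>graph\<close> again, and \<open>digraph_iso\<close>
  is isomorphism of undirected graphs.
\<close>

definition min_degree :: "('a, 'b) pre_digraph \<Rightarrow> nat" where
  "min_degree G = Min (out_degree G ` verts G)"

definition delete_verts :: "('a, 'b) pre_digraph \<Rightarrow> 'a set \<Rightarrow> ('a, 'b) pre_digraph" where
  "delete_verts G S = G \<restriction> (verts G - S)"

text \<open>
  The library's \<open>connected\<close> is false for the graph without vertices. Hence that graph has
  connectivity \<open>0\<close>, and admitting \<open>S = verts G\<close> below does not affect the minimum otherwise.
\<close>

definition connectivity :: "('a, 'b) pre_digraph \<Rightarrow> nat" where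
  "connectivity G = Min {card S | S. S \<subseteq> verts G \<and>
     (\<not> Digraph_Component.connected (delete_verts G S) \<or> card (verts (delete_verts G S)) = 1)}"

definition k_connected :: "nat \<Rightarrow> ('a, 'b) pre_digraph \<Rightarrow> bool" where
  "k_connected k G \<longleftrightarrow> k \<le> connectivity G"

definition independent_set :: "('a, 'b) pre_digraph \<Rightarrow> 'a set \<Rightarrow> bool" where
  "independent_set G A \<longleftrightarrow> A \<subseteq> verts G \<and> (\<forall>u \<in> A. \<forall>v \<in> A. \<not> u \<rightarrow>\<^bsub>G\<^esub> v)"

text \<open>A class may be empty (necessarily so for the one-vertex tree).\<close>

definition bipartition :: "('a, 'b) pre_digraph \<Rightarrow> 'a set \<Rightarrow> 'a set \<Rightarrow> bool" where
  "bipartition G X Y \<longleftrightarrow> X \<union> Y = verts G \<and> X \<inter> Y = {} \<and>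
     independent_set G X \<and> independent_set G Y"

definition bipartite :: "('a, 'b) pre_digraph \<Rightarrow> bool" where
  "bipartite G \<longleftrightarrow> (\<exists>X Y. bipartition G X Y)"

text \<open>
  The library's \<open>tree\<close> is not usable here, since its \<open>cycle\<close> includes the closed walk \<open>u, v, u\<close>
  along an edge and back. The cycles of an undirected graph are the ones of length at least \<open>3\<close>.
\<close>

definition undirected_tree :: "('a, 'b) pre_digraph \<Rightarrow> bool" where
  "undirected_tree G \<longleftrightarrow> graph G \<and> Digraph_Component.connected G \<and>
     \<not> (\<exists>p. pre_digraph.cycle G p \<and> 3 \<le> length p)"

definition spider :: "('a, 'b) pre_digraph \<Rightarrow> bool" where
  "spider G \<longleftrightarrow> undirected_tree G \<and> card {v \<in> verts G. 2 < out_degree G v} \<le> 1"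

end

theory Submission
  imports Defs
begin

text \<open>
  Choose a copy of the spider in \<open>G\<close> and a biconnected vertex set \<open>D\<close> disjoint from it with \<open>D\<close> as
  large as possible, and suppose that the copy misses a vertex of \<open>R = V - D\<close>. Let \<open>S\<close> be the set of
  vertices of \<open>R\<close> with two neighbours in \<open>D\<close>.

  If \<open>S\<close> is empty, then a vertex outside \<open>D\<close> and a shortest ear of \<open>D\<close> has at most two neighbours in
  their union (three would give a shorter ear). What remains has minimum degree at least \<open>t\<close>, so it
  contains a copy of the spider, and \<open>D\<close> can be enlarged by the ear.

  If \<open>S\<close> is not empty, then every copy of the spider in \<open>R\<close> contains \<open>S\<close>, since otherwise \<open>D\<close> could
  be enlarged by a vertex of \<open>S\<close>, and the vertices of \<open>R - S\<close> have degree at least \<open>t + 1\<close> in \<open>R\<close>.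
  Rerouting a leg from a vertex before its last vertex in \<open>S\<close> would avoid the latter; hence nothing
  before the last vertices in \<open>S\<close> is adjacent to a vertex outside the copy. This gives the vertices
  outside enough neighbours elsewhere to embed the spider in \<open>R\<close> without its old centre, which
  belongs to \<open>S\<close>.
\<close>

section \<open>Embedding spiders greedily\<close>

text \<open>
  Position \<open>(l, p)\<close> is the vertex at distance \<open>p\<close> from the centre on leg \<open>l\<close>; the centre is \<open>(0, 0)\<close>,
  whatever the leg.
\<close>

definition pos :: "nat \<Rightarrow> (nat \<Rightarrow> nat) \<Rightarrow> (nat \<times> nat) set" where
  "pos n k = insert (0, 0) {(l, p). l < n \<and> 1 \<le> p \<and> p \<le> k l}"

text \<open>No \<open>(l, 0)\<close> stands for the centre, so the first vertices of all legs are
  sent to \<open>(0, 0)\<close>. The centre is its own parent, which lets \<open>par_closed\<close>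
  do without an exception.\<close>

definition par :: "nat \<times> nat \<Rightarrow> nat \<times> nat" where
  "par q = (if snd q \<le> 1 then (0, 0) else (fst q, snd q - 1))"

text \<open>Inside \<open>pos n k\<close> these are the subtrees containing the centre, the domains
  of partial embeddings.\<close>

definition par_closed :: "(nat \<times> nat) set \<Rightarrow> bool" where
  "par_closed Q \<longleftrightarrow> (0, 0) \<in> Q \<and> (\<forall>q\<in>Q. par q \<in> Q)"

lemma finite_pos: "finite (pos n k)"
proof -
  have "pos n k \<subseteq> insert (0, 0) (\<Union>l<n. {l} \<times> {..k l})"
    by (auto simp: pos_def)
  then show ?thesis by (rule finite_subset) auto
qed

lemma par_closed_pos: "par_closed (pos n k)"
  by (auto simp: par_closed_def pos_def par_def)

lemma par_closed_root: "par_closed {(0, 0)}"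
  by (simp add: par_closed_def par_def)

lemma root_in_pos [simp]: "(0, 0) \<in> pos n k"
  by (simp add: pos_def)

lemma snd_par: "q \<in> pos n k \<Longrightarrow> q \<noteq> (0, 0) \<Longrightarrow> snd q = Suc (snd (par q))"
  by (auto simp: pos_def par_def)

lemma image_extension:
  assumes "\<forall>q\<in>Q. g q = f q" "g ` (P - Q) \<subseteq> A"
  shows "g ` P \<subseteq> A \<union> f ` Q"
proof
  fix x assume "x \<in> g ` P"
  then obtain q where "q \<in> P" "x = g q" by blast
  then show "x \<in> A \<union> f ` Q" using assms by (cases "q \<in> Q") auto
qed

text \<open>A bipartite graph as an adjacency relation with a two-colouring; both the spider and
  \<open>G\<close> become instances.\<close>

locale host =
  fixes V :: "'c set" and E :: "'c \<Rightarrow> 'c \<Rightarrow> bool" and col :: "'c \<Rightarrow> bool"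
  assumes finite_V: "finite V"
    and E_V: "E u v \<Longrightarrow> v \<in> V"
    and E_sym: "E u v \<Longrightarrow> E v u"
    and E_col: "E u v \<Longrightarrow> col u \<noteq> col v"

context host
begin

text \<open>Copies need not be induced. Membership of the image in \<open>V\<close> is stated
  separately, since a lone centre is not placed in \<open>V\<close> here.\<close>

definition embeds :: "(nat \<times> nat) set \<Rightarrow> (nat \<times> nat \<Rightarrow> 'c) \<Rightarrow> bool" where
  "embeds Q f \<longleftrightarrow> inj_on f Q \<and> (\<forall>q\<in>Q. q \<noteq> (0, 0) \<longrightarrow> E (f (par q)) (f q))"

lemma embeds_insert:
  assumes "par_closed Q" "embeds Q f" "v \<notin> Q" "par v \<in> Q" "u \<notin> f ` Q" "E (f (par v)) u"
  shows "embeds (insert v Q) (f(v := u))" and "par_closed (insert v Q)"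
proof -
  show "par_closed (insert v Q)" using assms by (auto simp: par_closed_def)
  have "inj_on (f(v := u)) (insert v Q)"
    using assms by (auto simp: embeds_def inj_on_def)
  moreover have "E ((f(v := u)) (par q)) ((f(v := u)) q)" if "q \<in> insert v Q" "q \<noteq> (0, 0)" for q
    using that assms by (auto simp: embeds_def par_closed_def)
  ultimately show "embeds (insert v Q) (f(v := u))" by (simp add: embeds_def)
qed

end

locale spider_host = host V E col
  for V :: "'c set" and E :: "'c \<Rightarrow> 'c \<Rightarrow> bool" and col :: "'c \<Rightarrow> bool" +
  fixes n :: nat and k :: "nat \<Rightarrow> nat"
begin

text \<open>Colours alternate along the legs, so each parity class of positions goes to one colour
  class.\<close>

lemma embeds_col:
  assumes "par_closed Q" "Q \<subseteq> pos n k" "embeds Q f" "q \<in> Q"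
  shows "col (f q) \<longleftrightarrow> (col (f (0, 0)) \<longleftrightarrow> even (snd q))"
  using assms(4)
proof (induction "snd q" arbitrary: q rule: less_induct)
  case less
  show ?case
  proof (cases "q = (0, 0)")
    case False
    with less.prems assms have q: "par q \<in> Q" "snd q = Suc (snd (par q))" "E (f (par q)) (f q)"
      by (auto simp: par_closed_def embeds_def intro!: snd_par)
    from less.hyps[of "par q"] q E_col[OF q(3)] show ?thesis by auto
  qed simp
qed

text \<open>Greedy extension with new vertices from \<open>A\<close>. Only the positions whose
  colour differs from that of \<open>w\<close> compete for neighbours of \<open>w\<close>; if
  \<open>w\<close> has at least as many neighbours as there are such positions, one is available
  while such a position is unfilled. Growth happens only at vertices of \<open>W\<close>: either all
  new vertices belong to \<open>W\<close>, or no new position has a new parent.\<close>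

lemma extend_embedding:
  assumes "par_closed P" "P \<subseteq> pos n k" "par_closed Q" "Q \<subseteq> P" "embeds Q f"
    and deg: "\<And>w b. w \<in> W \<Longrightarrow> col w \<noteq> (col (f (0, 0)) \<longleftrightarrow> b) \<Longrightarrow>
      card {q \<in> P. even (snd q) \<longleftrightarrow> b} \<le> card {u \<in> A \<union> f ` Q. E w u}"
    and "\<And>v. v \<in> P - Q \<Longrightarrow> par v \<in> Q \<Longrightarrow> f (par v) \<in> W"
    and "A \<subseteq> W \<or> (\<forall>v\<in>P - Q. par v \<in> Q)"
  shows "\<exists>g. embeds P g \<and> (\<forall>q\<in>Q. g q = f q) \<and> g ` (P - Q) \<subseteq> A"
  using assms(3-8)
proof (induction "card (P - Q)" arbitrary: Q f)
  case 0
  have "finite P" using assms(2) finite_pos finite_subset by blast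
  with 0 have "P = Q" by auto
  with 0 show ?case by blast
next
  case (Suc m)
  have finP: "finite P" using assms(2) finite_pos finite_subset by blast
  with Suc.prems(2) have finQ: "finite Q" using finite_subset by blast
  have ne: "P - Q \<noteq> {}" using Suc.hyps(2) by force
  \<comment> \<open>Minimal distance from the centre puts the parent of \<open>v\<close> into
    \<open>Q\<close>.\<close>
  define v where "v = arg_min_on snd (P - Q)"
  have v: "v \<in> P - Q" and vmin: "\<And>u. u \<in> P - Q \<Longrightarrow> snd v \<le> snd u"
    unfolding v_def using arg_min_if_finite[of "P - Q" snd] finP ne
    by (auto simp: not_less[symmetric])
  have v0: "v \<noteq> (0, 0)" using v Suc.prems(1) by (auto simp: par_closed_def)
  have sv: "snd v = Suc (snd (par v))" using v v0 assms(2) by (auto intro!: snd_par)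
  have pv: "par v \<in> Q"
    using v vmin[of "par v"] sv assms(1) by (auto simp: par_closed_def)
  let ?w = "f (par v)"
  have w: "?w \<in> W" using Suc.prems(5) v pv by auto
  have colw: "col ?w \<longleftrightarrow> (col (f (0,0)) \<longleftrightarrow> even (snd (par v)))"
    using embeds_col[of Q f "par v"] Suc.prems pv assms(2) by auto
  let ?b = "even (snd v)"
  let ?B = "{u \<in> A \<union> f ` Q. E ?w u}"
  have le: "card {q \<in> P. even (snd q) \<longleftrightarrow> ?b} \<le> card ?B"
    by (rule Suc.prems(4)[OF w]) (use colw sv in auto)
  \<comment> \<open>The used neighbours of \<open>?w\<close> come from positions with the parity of
    \<open>v\<close>. As \<open>v\<close> is not in \<open>Q\<close>, they are fewer than
    \<open>card ?B\<close>, which leaves a neighbour in \<open>A\<close>.\<close>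
  have "?B \<inter> f ` Q \<subseteq> f ` {q \<in> Q. even (snd q) \<longleftrightarrow> ?b}"
  proof
    fix u assume "u \<in> ?B \<inter> f ` Q"
    then obtain q where q: "q \<in> Q" "u = f q" "E ?w (f q)" by auto
    have "col (f q) \<longleftrightarrow> (col (f (0,0)) \<longleftrightarrow> even (snd q))"
      using embeds_col[of Q f q] Suc.prems q assms(2) by auto
    with E_col[OF q(3)] colw sv have "even (snd q) \<longleftrightarrow> ?b" by auto
    with q show "u \<in> f ` {q \<in> Q. even (snd q) \<longleftrightarrow> ?b}" by blast
  qed
  then have "card (?B \<inter> f ` Q) \<le> card {q \<in> Q. even (snd q) \<longleftrightarrow> ?b}"
    using finQ by (intro surj_card_le) auto
  also have "\<dots> < card {q \<in> P. even (snd q) \<longleftrightarrow> ?b}"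
    using finP v Suc.prems(2) by (intro psubset_card_mono) auto
  also note le
  finally have "?B \<inter> f ` Q \<noteq> ?B" by auto
  then obtain u where u: "u \<in> A" "E ?w u" "u \<notin> f ` Q" by auto
  let ?f = "f(v := u)" and ?Q = "insert v Q"
  have im: "?f ` ?Q = insert u (f ` Q)" using v by auto
  have "embeds ?Q ?f" "par_closed ?Q"
    using embeds_insert[of Q f v u] Suc.prems(1,3) v pv u by auto
  moreover have root: "?f (0,0) = f (0,0)" using v0 by auto
  moreover have "card (P - ?Q) = m"
    using Suc.hyps(2) v finP by (metis Diff_insert card_Suc_Diff1 finite_Diff nat.inject)
  moreover have "card {q \<in> P. even (snd q) \<longleftrightarrow> b} \<le> card {x \<in> A \<union> ?f ` ?Q. E w x}"
    if "w \<in> W" "col w \<noteq> (col (?f (0, 0)) \<longleftrightarrow> b)" for w b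
  proof -
    have "A \<union> ?f ` ?Q = A \<union> f ` Q" unfolding im using u by auto
    then show ?thesis
      using Suc.prems(4)[OF that(1), of b] that(2) unfolding root by simp
  qed
  moreover have "?f (par x) \<in> W" if "x \<in> P - ?Q" "par x \<in> ?Q" for x
    using that Suc.prems(5,6) v u by (cases "par x = v") auto
  ultimately obtain g where g: "embeds P g" "\<forall>q\<in>?Q. g q = ?f q" "g ` (P - ?Q) \<subseteq> A"
    using Suc.hyps(1)[of ?Q ?f] Suc.prems(2,6) v by blast
  have "g v = u" using g by simp
  then have "g ` (P - Q) \<subseteq> A" using g(3) u by auto
  moreover have "\<forall>q\<in>Q. g q = f q" using g(2) v by auto
  ultimately show ?case using g(1) by blast
qed

text \<open>All neighbours of \<open>w\<close> have the other colour, so those in the copy come from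
  a single parity class.\<close>

lemma embeds_card_nbrs:
  assumes "embeds (pos n k) f" and class_le: "\<And>b. card {q \<in> pos n k. even (snd q) \<longleftrightarrow> b} \<le> t"
  shows "card {u \<in> f ` pos n k. E w u} \<le> t"
proof -
  let ?b = "col w \<longleftrightarrow> \<not> col (f (0,0))"
  have "{u \<in> f ` pos n k. E w u} \<subseteq> f ` {q \<in> pos n k. even (snd q) \<longleftrightarrow> ?b}"
  proof
    fix u assume "u \<in> {u \<in> f ` pos n k. E w u}"
    then obtain q where q: "q \<in> pos n k" "u = f q" "E w (f q)" by auto
    then have "even (snd q) \<longleftrightarrow> ?b"
      using embeds_col[OF par_closed_pos _ assms(1) q(1)] E_col[OF q(3)] by auto
    with q show "u \<in> f ` {q \<in> pos n k. even (snd q) \<longleftrightarrow> ?b}" by blast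
  qed
  then have "card {u \<in> f ` pos n k. E w u} \<le> card {q \<in> pos n k. even (snd q) \<longleftrightarrow> ?b}"
    using finite_pos by (intro surj_card_le) auto
  with class_le[of ?b] show ?thesis by linarith
qed

lemma greedy_embedding:
  assumes "z \<in> W" "\<And>w. w \<in> W \<Longrightarrow> t \<le> card {u \<in> W. E w u}"
    and class_le: "\<And>b. card {q \<in> pos n k. even (snd q) \<longleftrightarrow> b} \<le> t"
  obtains g where "embeds (pos n k) g" "g ` pos n k \<subseteq> W"
proof -
  let ?Q = "{(0, 0)}" and ?g = "\<lambda>_. z"
  have A: "W \<union> ?g ` ?Q = W" using assms(1) by auto
  have "\<exists>h. embeds (pos n k) h \<and> (\<forall>q\<in>?Q. h q = ?g q) \<and> h ` (pos n k - ?Q) \<subseteq> W"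
  proof (rule extend_embedding[where W = W])
    fix w b assume "w \<in> W"
    then show "card {q \<in> pos n k. even (snd q) = b} \<le> card {u \<in> W \<union> ?g ` ?Q. E w u}"
      unfolding A using assms(2) class_le[of b] le_trans by blast
  qed (use assms(1) in \<open>auto simp: par_closed_pos par_closed_root embeds_def\<close>)
  then obtain h where h: "embeds (pos n k) h" "\<forall>q\<in>?Q. h q = ?g q" "h ` (pos n k - ?Q) \<subseteq> W" by blast
  have "h ` pos n k \<subseteq> W" using image_extension[OF h(2,3)] A by simp
  then show thesis using that h(1) by blast
qed

end

section \<open>Copies of the spider that all share a vertex set\<close>

definition at_leg :: "nat \<Rightarrow> nat \<Rightarrow> nat \<times> nat" where
  "at_leg l p = (if p = 0 then (0, 0) else (l, p))"

lemma par_leg: "1 \<le> p \<Longrightarrow> par (l, p) = at_leg l (p - 1)"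
  by (auto simp: par_def at_leg_def)

lemma at_leg_pos: "l < n \<Longrightarrow> p \<le> k l \<Longrightarrow> at_leg l p \<in> pos n k"
  by (auto simp: at_leg_def pos_def)

lemma at_leg_Pair: "1 \<le> p \<Longrightarrow> at_leg l p = (l, p)"
  by (simp add: at_leg_def)

text \<open>
  In the application \<open>R\<close> is the complement of a largest biconnected set avoiding a copy of the
  spider, and \<open>S\<close> consists of the vertices of \<open>R\<close> that could be added to that set.
\<close>

locale critical = spider_host V E col n k
  for V :: "'c set" and E :: "'c \<Rightarrow> 'c \<Rightarrow> bool" and col :: "'c \<Rightarrow> bool"
    and n :: nat and k :: "nat \<Rightarrow> nat" +
  fixes R S :: "'c set" and t :: nat
  assumes R_V: "R \<subseteq> V"
    and deg: "w \<in> R \<Longrightarrow> w \<notin> S \<Longrightarrow> t + 1 \<le> card {u \<in> R. E w u}"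
    and class_le: "card {q \<in> pos n k. even (snd q) \<longleftrightarrow> b} \<le> t"
    and k_pos: "l < n \<Longrightarrow> 1 \<le> k l"
    and contains_S: "embeds (pos n k) f \<Longrightarrow> f ` pos n k \<subseteq> R \<Longrightarrow> S \<subseteq> f ` pos n k"
begin

section \<open>Rerouting legs of a copy inside \<open>R\<close>\<close>

lemma finite_R: "finite R"
  using R_V finite_V finite_subset by blast

text \<open>Vertices outside \<open>S\<close> can give up the one neighbour \<open>s\<close> and
  still have the \<open>t\<close> neighbours that greedy extension asks for.\<close>

lemma deg_avoiding:
  assumes "w \<in> R" "w \<notin> S" "{u \<in> R. E w u} \<subseteq> insert s {u \<in> B. E w u}" "finite B"
  shows "t \<le> card {u \<in> B. E w u}"
proof -
  have "card {u \<in> R. E w u} \<le> card (insert s {u \<in> B. E w u})"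
    using assms by (intro card_mono) auto
  also have "\<dots> \<le> Suc (card {u \<in> B. E w u})"
    using assms by (simp add: card_insert_if)
  finally show ?thesis using deg[OF assms(1,2)] by simp
qed

text \<open>An edge to \<open>z\<close> would allow leg \<open>l\<close> to branch off before
  position \<open>i\<close> and be completed without \<open>f (l, i)\<close>, although every copy in
  \<open>R\<close> contains \<open>S\<close>.\<close>

lemma no_edge_before_last:
  assumes f: "embeds (pos n k) f" "f ` pos n k \<subseteq> R"
    and i: "l < n" "1 \<le> i" "i \<le> k l" "f (l, i) \<in> S" "\<And>p. i < p \<Longrightarrow> p \<le> k l \<Longrightarrow> f (l, p) \<notin> S"
    and j: "j < i" and z: "z \<in> R - f ` pos n k \<or> z \<in> f ` {(l, p) |p. i < p \<and> p \<le> k l}"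
  shows "\<not> E (f (at_leg l j)) z"
proof
  assume Ez: "E (f (at_leg l j)) z"
  \<comment> \<open>The supply for the new leg. It avoids \<open>S\<close>, because the copy
    contains \<open>S\<close> and position \<open>i\<close> is the last one of its leg in
    \<open>S\<close>.\<close>
  define W where "W = (R - f ` pos n k) \<union> f ` {(l, p) |p. i < p \<and> p \<le> k l}"
  \<comment> \<open>Branching off at the last possible position \<open>Max J\<close> ensures that no
    vertex of \<open>W\<close> is adjacent to the discarded vertices strictly between it and
    \<open>i\<close>. Hence \<open>f (l, i)\<close> is the only neighbour that a vertex of
    \<open>W\<close> can lose.\<close>
  define J where "J = {j. j < i \<and> (\<exists>z\<in>W. E (f (at_leg l j)) z)}"
  have "j \<in> J" using j z Ez by (auto simp: J_def W_def)
  moreover have "finite J" by (simp add: J_def)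
  ultimately have m: "Max J \<in> J" and mm: "\<And>j. j \<in> J \<Longrightarrow> j \<le> Max J"
    by (auto intro: Max_in)
  define m where "m = Max J"
  from m obtain y where m_i: "m < i" and y: "y \<in> W" "E (f (at_leg l m)) y"
    by (auto simp: m_def J_def)
  have no: "\<not> E x (f (l, p))" if "m < p" "p < i" "x \<in> W" for p x
  proof
    assume "E x (f (l, p))"
    then have "p \<in> J" using that E_sym by (auto simp: J_def at_leg_def)
    from mm[OF this] that show False by (simp add: m_def)
  qed
  let ?P = "pos n k"
  define Q0 where "Q0 = ?P - {(l, p) |p. m < p}"
  define Q where "Q = insert (l, Suc m) Q0"
  define g where "g = f((l, Suc m) := y)"
  have inj: "inj_on f ?P" using f by (simp add: embeds_def)
  have gQ0: "g ` Q0 = f ` Q0" by (auto simp: g_def Q0_def image_iff)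
  have gQ: "g ` Q = insert y (f ` Q0)" unfolding Q_def image_insert gQ0 by (simp add: g_def)
  have tail: "{(l, p) |p. i < p \<and> p \<le> k l} \<subseteq> ?P" using i by (auto simp: pos_def)
  have W_Q0: "W \<inter> f ` Q0 = {}"
  proof -
    have "f ` {(l, p) |p. i < p \<and> p \<le> k l} \<inter> f ` Q0 = {}"
    proof -
      have "{(l, p) |p. i < p \<and> p \<le> k l} \<inter> Q0 = {}" using m_i by (auto simp: Q0_def)
      moreover have "Q0 \<subseteq> ?P" by (auto simp: Q0_def)
      ultimately show ?thesis using inj_on_image_Int[OF inj tail, of Q0] by simp
    qed
    then show ?thesis unfolding W_def by (auto simp: Q0_def)
  qed
  have fi: "f (l, i) \<notin> W \<union> g ` Q"
  proof -
    have li: "(l, i) \<in> ?P" using i by (auto simp: pos_def)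
    then have "f (l, i) \<notin> f ` Q0" "f (l, i) \<notin> W"
      using inj m_i tail by (auto simp: W_def Q0_def inj_on_def)
    then show ?thesis using y gQ by auto
  qed
  have Q: "par_closed Q" "Q \<subseteq> ?P"
  proof -
    have "par q \<in> Q0" if "q \<in> Q0" for q
      using that by (auto simp: Q0_def pos_def par_def)
    moreover have "par (l, Suc m) \<in> Q0"
      using m_i i by (auto simp: Q0_def pos_def par_def)
    moreover have "(0,0) \<in> Q0" by (auto simp: Q0_def)
    ultimately show "par_closed Q" by (auto simp: par_closed_def Q_def)
    show "Q \<subseteq> ?P" using m_i i by (auto simp: Q_def Q0_def pos_def)
  qed
  have emb: "embeds Q g"
    unfolding embeds_def
  proof (intro conjI ballI impI)
    have "inj_on g Q0" using inj by (auto simp: inj_on_def g_def Q0_def)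
    then show "inj_on g Q"
      using W_Q0 y gQ0 by (auto simp: Q_def g_def)
    fix q assume q: "q \<in> Q" "q \<noteq> (0,0)"
    show "E (g (par q)) (g q)"
    proof (cases "q = (l, Suc m)")
      case True
      then show ?thesis using y by (auto simp: g_def par_leg at_leg_def)
    next
      case False
      then have "q \<in> Q0" using q by (simp add: Q_def)
      then have "par q \<noteq> (l, Suc m)" "q \<in> ?P"
        by (auto simp: Q0_def pos_def par_def split: if_splits)
      then show ?thesis using False q f by (auto simp: g_def embeds_def)
    qed
  qed
  have finW: "finite (W \<union> g ` Q)"
    using finite_R finite_pos[of n k] Q(2) finite_subset[OF tail]
    by (auto simp: W_def intro: finite_subset)
  have W_R: "W \<subseteq> R" using f tail by (auto simp: W_def)
  have W_S: "w \<notin> S" if "w \<in> W" for w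
    using that i(5) contains_S[OF f] by (auto simp: W_def)
  have degW: "t \<le> card {u \<in> W \<union> g ` Q. E w u}" if w: "w \<in> W" for w
  proof (rule deg_avoiding[where s = "f (l, i)"])
    show "{u \<in> R. E w u} \<subseteq> insert (f (l, i)) {u \<in> W \<union> g ` Q. E w u}"
    proof
      fix u assume u: "u \<in> {u \<in> R. E w u}"
      show "u \<in> insert (f (l, i)) {u \<in> W \<union> g ` Q. E w u}"
      proof (cases "u \<in> f ` ?P")
        case False
        then show ?thesis using u by (auto simp: W_def)
      next
        case True
        then obtain q where q: "q \<in> ?P" "u = f q" by blast
        show ?thesis
        proof (cases "q \<in> Q0")
          case True
          then show ?thesis using q u gQ by auto
        next
          case False
          then obtain p where p: "q = (l, p)" "m < p" using q by (auto simp: Q0_def)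
          have "p \<le> k l" using p q by (auto simp: pos_def)
          then show ?thesis
            using no[of p w] p u q w by (cases p i rule: linorder_cases) (auto simp: W_def)
        qed
      qed
    qed
  qed (use W_R W_S w finW in auto)
  have "\<exists>h. embeds ?P h \<and> (\<forall>q\<in>Q. h q = g q) \<and> h ` (?P - Q) \<subseteq> W"
  proof (rule extend_embedding[where W = W])
    fix v assume "v \<in> ?P - Q" "par v \<in> Q"
    then have "par v = (l, Suc m)"
      by (auto simp: Q_def Q0_def pos_def par_def split: if_splits)
    then show "g (par v) \<in> W" using y by (simp add: g_def)
  next
    fix w b assume "w \<in> W"
    then show "card {q \<in> pos n k. even (snd q) = b} \<le> card {u \<in> W \<union> g ` Q. E w u}"
      using degW class_le[of b] le_trans by blast
  qed (use Q emb in \<open>auto simp: par_closed_pos\<close>)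
  then obtain h where h: "embeds ?P h" "\<forall>q\<in>Q. h q = g q" "h ` (?P - Q) \<subseteq> W" by blast
  have "h ` ?P \<subseteq> W \<union> g ` Q" by (rule image_extension[OF h(2,3)])
  moreover have "g ` Q \<subseteq> R" using gQ y W_R f by (auto simp: Q0_def)
  ultimately have "S \<subseteq> W \<union> g ` Q" using contains_S[OF h(1)] W_R by blast
  then show False using fi i(4) by blast
qed

text \<open>The default \<open>0\<close> means that no vertex of the leg beyond the centre is in
  \<open>S\<close>; it says nothing about the centre.\<close>

definition last_S :: "(nat \<times> nat \<Rightarrow> 'c) \<Rightarrow> nat \<Rightarrow> nat" where
  "last_S f l = Max (insert 0 {p. 1 \<le> p \<and> p \<le> k l \<and> f (l, p) \<in> S})"

lemma last_S:
  shows "last_S f l \<le> k l"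
    and "1 \<le> last_S f l \<Longrightarrow> f (l, last_S f l) \<in> S"
    and "last_S f l < p \<Longrightarrow> p \<le> k l \<Longrightarrow> f (l, p) \<notin> S"
proof -
  let ?A = "{p. 1 \<le> p \<and> p \<le> k l \<and> f (l, p) \<in> S}"
  have fin: "finite (insert 0 ?A)" by simp
  have "last_S f l \<in> insert 0 ?A" unfolding last_S_def using fin by (intro Max_in) auto
  then show "last_S f l \<le> k l" "1 \<le> last_S f l \<Longrightarrow> f (l, last_S f l) \<in> S" by auto
  assume p: "last_S f l < p" "p \<le> k l"
  show "f (l, p) \<notin> S"
  proof
    assume "f (l, p) \<in> S"
    then have "p \<le> last_S f l" unfolding last_S_def using p fin by (intro Max_ge) auto
    then show False using p by simp
  qed
qed

text \<open>On a leg with \<open>last_S f l = 0\<close> only the centre is concerned. The centre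
  precedes the last vertex in \<open>S\<close> of leg \<open>l0\<close>, so it is handled through
  that leg.\<close>

lemma no_edge_core_outside:
  assumes f: "embeds (pos n k) f" "f ` pos n k \<subseteq> R"
    and l0: "l0 < n" "1 \<le> last_S f l0"
    and j: "l < n" "j < max 1 (last_S f l)" and z: "z \<in> R - f ` pos n k"
  shows "\<not> E (f (at_leg l j)) z"
proof (cases "j = 0")
  case True
  have "\<not> E (f (at_leg l0 0)) z"
    by (rule no_edge_before_last[OF f l0]) (use last_S[of f l0] l0 z in auto)
  then show ?thesis using True by (simp add: at_leg_def)
next
  case False
  then show ?thesis
    by (intro no_edge_before_last[OF f j(1), of "last_S f l"]) (use last_S[of f l] j z in auto)
qed

text \<open>Leg \<open>l'\<close> can be re-embedded from position \<open>p\<close> on without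
  \<open>f (l', p)\<close>. That vertex is then outside a copy to which
  \<open>no_edge_core_outside\<close> applies. The distance of two keeps the vertex at
  \<open>p - 1\<close>, where regrowth starts, outside \<open>S\<close>.\<close>

lemma no_edge_core_tail:
  assumes f: "embeds (pos n k) f" "f ` pos n k \<subseteq> R"
    and l0: "l0 < n" "1 \<le> last_S f l0"
    and j: "l < n" "j < max 1 (last_S f l)"
    and p: "l' < n" "last_S f l' + 2 \<le> p" "p \<le> k l'"
  shows "\<not> E (f (at_leg l j)) (f (l', p))"
proof -
  let ?P = "pos n k" and ?z = "f (l', p)"
  define Q where "Q = ?P - {(l', q) |q. p \<le> q}"
  define W where "W = R - S - {?z}"
  have inj: "inj_on f ?P" using f by (simp add: embeds_def)
  have zP: "(l', p) \<in> ?P" using p by (auto simp: pos_def)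
  have Q: "par_closed Q" "Q \<subseteq> ?P"
    by (auto simp: Q_def par_closed_def pos_def par_def split: if_splits)
       (use p in auto)
  have embQ: "embeds Q f" using f Q(2) inj_on_subset[OF inj] by (auto simp: embeds_def)
  have nS: "f q \<notin> S" if "q \<in> ?P - Q" for q
    using that last_S(3)[of f l'] p by (auto simp: Q_def pos_def)
  \<comment> \<open>All of \<open>S\<close> sits on kept positions, so excluding \<open>S\<close>
    from \<open>W\<close> hides no neighbour; only \<open>?z\<close> is lost.\<close>
  have S_Q: "S \<subseteq> f ` Q"
    using contains_S[OF f] nS by blast
  have fin: "finite (W \<union> f ` Q)"
    using finite_R finite_pos[of n k] Q(2) by (auto simp: W_def intro: finite_subset)
  have degW: "t \<le> card {u \<in> W \<union> f ` Q. E w u}" if w: "w \<in> W" for w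
    by (rule deg_avoiding[where s = ?z]) (use w fin S_Q in \<open>auto simp: W_def\<close>)
  have "\<exists>g. embeds ?P g \<and> (\<forall>q\<in>Q. g q = f q) \<and> g ` (?P - Q) \<subseteq> W"
  proof (rule extend_embedding[where W = W])
    fix v assume "v \<in> ?P - Q" "par v \<in> Q"
    then have v: "par v = (l', p - 1)"
      using p by (auto simp: Q_def pos_def par_def split: if_splits)
    have "f (l', p - 1) \<notin> S" using last_S(3)[of f l' "p - 1"] p by auto
    moreover have "(l', p - 1) \<in> ?P" using p by (auto simp: pos_def)
    moreover have "f (l', p - 1) \<noteq> ?z"
      using inj_onD[OF inj _ \<open>(l', p - 1) \<in> ?P\<close> zP] p by auto
    ultimately show "f (par v) \<in> W" using f v by (auto simp: W_def)
  next
    fix w b assume "w \<in> W"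
    then show "card {q \<in> pos n k. even (snd q) = b} \<le> card {u \<in> W \<union> f ` Q. E w u}"
      using degW class_le[of b] le_trans by blast
  qed (use Q embQ in \<open>auto simp: par_closed_pos\<close>)
  then obtain g where g: "embeds ?P g" "\<forall>q\<in>Q. g q = f q" "g ` (?P - Q) \<subseteq> W" by blast
  have gR: "g ` ?P \<subseteq> R"
  proof
    fix x assume "x \<in> g ` ?P"
    then obtain q where q: "q \<in> ?P" "x = g q" by blast
    show "x \<in> R" using q g(2,3) f(2) by (cases "q \<in> Q") (auto simp: W_def)
  qed
  have zg: "?z \<notin> g ` ?P"
  proof
    assume "?z \<in> g ` ?P"
    then obtain q where q: "q \<in> ?P" "?z = g q" by blast
    show False
    proof (cases "q \<in> Q")
      case True
      then have "f q = ?z" using g(2) q by simp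
      then have "q = (l', p)" using inj_onD[OF inj _ q(1) zP] by blast
      then show False using True by (auto simp: Q_def)
    next
      case False
      then show False using g(3) q by (auto simp: W_def)
    qed
  qed
  \<comment> \<open>The re-embedded positions avoid \<open>S\<close> in both copies, so
    \<open>last_S\<close> does not change.\<close>
  have iff: "g (m, q) \<in> S \<longleftrightarrow> f (m, q) \<in> S" if "m < n" "1 \<le> q" "q \<le> k m" for m q
  proof (cases "(m, q) \<in> Q")
    case True
    then show ?thesis using g(2) by simp
  next
    case False
    moreover have "(m, q) \<in> ?P" using that by (auto simp: pos_def)
    ultimately show ?thesis using nS[of "(m, q)"] g(3) by (auto simp: W_def)
  qed
  have last_eq: "last_S g m = last_S f m" if "m < n" for m
  proof -
    have "{p. 1 \<le> p \<and> p \<le> k m \<and> g (m, p) \<in> S} = {p. 1 \<le> p \<and> p \<le> k m \<and> f (m, p) \<in> S}"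
      using iff that by blast
    then show ?thesis by (simp add: last_S_def)
  qed
  have "at_leg l j \<in> ?P"
    using j last_S(1)[of f l] k_pos[of l] by (intro at_leg_pos) auto
  then have "at_leg l j \<in> Q"
    using j p by (auto simp: Q_def at_leg_def split: if_splits)
  then have "g (at_leg l j) = f (at_leg l j)" using g(2) by simp
  moreover have "?z \<in> R - g ` ?P" using zg zP f by auto
  ultimately show ?thesis
    using no_edge_core_outside[OF g(1) gR l0(1), of l j ?z] last_eq l0 j by auto
qed

text \<open>A copy holds at most \<open>t\<close> neighbours of \<open>w\<close>, while
  \<open>R\<close> holds at least \<open>t + 1\<close>.\<close>

lemma nbr_outside_image:
  assumes "embeds (pos n k) f" "w \<in> R" "w \<notin> S"
  shows "\<exists>u \<in> R - f ` pos n k. E w u"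
proof (rule ccontr)
  assume "\<not> ?thesis"
  then have "{u \<in> R. E w u} \<subseteq> {u \<in> f ` pos n k. E w u}" by auto
  then have "card {u \<in> R. E w u} \<le> card {u \<in> f ` pos n k. E w u}"
    by (intro card_mono) (simp_all add: finite_pos)
  with embeds_card_nbrs[OF assms(1) class_le, of w] deg[OF assms(2,3)] show False by linarith
qed

text \<open>Removing the centre alone would leave minimum degree \<open>t\<close>, and a greedy copy
  in the rest would miss \<open>S\<close>. The vertex \<open>z\<close> makes the rest
  nonempty.\<close>

lemma S_not_root:
  assumes f: "embeds (pos n k) f" "f ` pos n k \<subseteq> R" and z: "z \<in> R - f ` pos n k"
  shows "S \<noteq> {f (0, 0)}"
proof
  assume S: "S = {f (0, 0)}"
  let ?W = "R - S"
  have zW: "z \<in> ?W" using z S by auto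
  have degW: "t \<le> card {u \<in> ?W. E w u}" if "w \<in> ?W" for w
    by (rule deg_avoiding[where s = "f (0,0)"]) (use that S finite_R in auto)
  obtain h where h: "embeds (pos n k) h" "h ` pos n k \<subseteq> ?W"
    by (rule greedy_embedding[OF zW degW class_le])
  show False using contains_S[OF h(1)] h(2) S by blast
qed

end

section \<open>Contradiction from a copy that misses \<open>x0\<close> and has a vertex of
  \<open>S\<close> beyond the centre on leg \<open>l0\<close>\<close>

locale critical_embedding = critical V E col n k R S t
  for V :: "'c set" and E :: "'c \<Rightarrow> 'c \<Rightarrow> bool" and col :: "'c \<Rightarrow> bool"
    and n :: nat and k :: "nat \<Rightarrow> nat" and R S :: "'c set" and t :: nat +
  fixes f :: "nat \<times> nat \<Rightarrow> 'c" and l0 :: nat and x0 :: 'c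
  assumes f: "embeds (pos n k) f" "f ` pos n k \<subseteq> R"
    and l0: "l0 < n" "1 \<le> last_S f l0"
    and x0: "x0 \<in> R - f ` pos n k"
begin

text \<open>
  The spider is cut after its last vertex in \<open>S\<close> on each leg (after the first one if there is none).
  No vertex of \<open>free\<close> has a neighbour in \<open>core\<close>, and \<open>R\<close> is the union of \<open>core\<close>, \<open>free\<close>, the adjacent
  vertices \<open>pair l\<close> around the cut of each \<open>long\<close> leg, and the ends of the other legs (the images of
  \<open>single\<close>). Deleting the last two positions of every long leg and the last one of every other leg
  leaves \<open>trunk\<close>, which therefore loses in each class exactly what \<open>free\<close> misses outside of \<open>core\<close>.
\<close>

definition cut :: "nat \<Rightarrow> nat" where "cut l = max 1 (last_S f l)"

definition core :: "'c set" where
  "core = {f (at_leg l j) |l j. l < n \<and> j < cut l}"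

definition long :: "nat set" where "long = {l. l < n \<and> cut l < k l}"

definition pair :: "nat \<Rightarrow> 'c set" where "pair l = {f (l, cut l), f (l, Suc (cut l))}"

definition single :: "(nat \<times> nat) set" where
  "single = {(l, k l) |l. l < n \<and> l \<notin> long}"

definition free :: "'c set" where
  "free = R - core - (\<Union>l\<in>long. pair l) - f ` single"

definition trunk :: "(nat \<times> nat) set" where
  "trunk = pos n k - single - {(l, p) |l p. l \<in> long \<and> (p = k l \<or> p = k l - 1)}"

lemma cut_bounds: "1 \<le> cut l" "last_S f l \<le> cut l" "l < n \<Longrightarrow> cut l \<le> k l"
  using k_pos[of l] last_S(1)[of f l] by (auto simp: cut_def)

lemma finite_long [simp]: "finite long"
  by (simp add: long_def)

lemma inj_f: "inj_on f (pos n k)"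
  using f by (simp add: embeds_def)

lemma single_pos: "single \<subseteq> pos n k"
  using k_pos by (auto simp: single_def pos_def)

lemma pair_pos: "l \<in> long \<Longrightarrow> (l, cut l) \<in> pos n k \<and> (l, Suc (cut l)) \<in> pos n k"
  using cut_bounds[of l] by (auto simp: long_def pos_def)

lemma root_in_core: "f (0, 0) \<in> core"
proof -
  have "f (0, 0) = f (at_leg l0 0)" "0 < cut l0" using cut_bounds(1)[of l0] by (auto simp: at_leg_def)
  with l0 show ?thesis unfolding core_def by blast
qed

text \<open>The two cases match \<open>no_edge_core_outside\<close> and
  \<open>no_edge_core_tail\<close>, which together separate \<open>free\<close> from
  \<open>core\<close>.\<close>

lemma free_cases:
  assumes "w \<in> free"
  obtains "w \<in> R - f ` pos n k"
  | l p where "l < n" "cut l + 2 \<le> p" "p \<le> k l" "w = f (l, p)"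
proof (cases "w \<in> f ` pos n k")
  case True
  then obtain q where q: "q \<in> pos n k" "w = f q" by blast
  have nroot: "q \<noteq> (0,0)"
  proof
    assume "q = (0,0)"
    then have "w \<in> core" using q root_in_core by simp
    then show False using assms by (simp add: free_def)
  qed
  then obtain l p where lp: "q = (l, p)" "l < n" "1 \<le> p" "p \<le> k l" using q by (auto simp: pos_def)
  have 1: "cut l \<le> p"
  proof (rule ccontr)
    assume "\<not> cut l \<le> p"
    then have "w = f (at_leg l p)" "p < cut l" using lp q by (auto simp: at_leg_Pair)
    then have "w \<in> core" using lp unfolding core_def by blast
    then show False using assms by (simp add: free_def)
  qed
  have "l \<in> long"
  proof (rule ccontr)
    assume "l \<notin> long"
    then have "(l, p) \<in> single" using 1 lp by (auto simp: single_def long_def)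
    then show False using assms lp q by (simp add: free_def)
  qed
  then have "w \<notin> pair l" using assms by (auto simp: free_def)
  then have "p \<noteq> cut l" "p \<noteq> Suc (cut l)" using q lp by (auto simp: pair_def)
  with 1 have "cut l + 2 \<le> p" by linarith
  with lp q that(2) show ?thesis by blast
qed (use that(1) assms in \<open>auto simp: free_def\<close>)

lemma core_image: "core \<subseteq> f ` pos n k"
proof
  fix c assume "c \<in> core"
  then obtain l j where c: "c = f (at_leg l j)" "l < n" "j < cut l" by (auto simp: core_def)
  then have "at_leg l j \<in> pos n k" using cut_bounds(3)[of l] by (intro at_leg_pos) auto
  then show "c \<in> f ` pos n k" using c by simp
qed

lemma outside_free: "R - f ` pos n k \<subseteq> free"
  using core_image single_pos pair_pos by (auto simp: free_def pair_def)

lemma free_core: "w \<in> free \<Longrightarrow> c \<in> core \<Longrightarrow> \<not> E w c"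
proof
  assume w: "w \<in> free" and c: "c \<in> core" and E: "E w c"
  obtain l j where lj: "c = f (at_leg l j)" "l < n" "j < max 1 (last_S f l)"
    using c by (auto simp: core_def cut_def)
  from w show False
  proof (cases rule: free_cases)
    case 1
    then show ?thesis using no_edge_core_outside[OF f l0 lj(2,3)] E_sym[OF E] lj(1) by auto
  next
    case (2 l' p)
    then show ?thesis
      using no_edge_core_tail[OF f l0 lj(2,3), of l' p] cut_bounds(2)[of l'] E_sym[OF E] lj(1) by auto
  qed
qed

lemma free_not_S: "w \<in> free \<Longrightarrow> w \<notin> S"
proof -
  assume "w \<in> free"
  then show ?thesis
  proof (cases rule: free_cases)
    case 1
    then show ?thesis using contains_S[OF f] by auto
  next
    case (2 l p)
    then show ?thesis using last_S(3)[of f l p] cut_bounds(2)[of l] by auto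
  qed
qed

text \<open>As no neighbour lies in \<open>core\<close>, the degree bound for vertices outside
  \<open>S\<close> survives the removal of \<open>core\<close>.\<close>

lemma deg_off_core:
  assumes "w \<in> free"
  shows "t + 1 \<le> card {u \<in> R - core. E w u}"
proof -
  have "{u \<in> R. E w u} = {u \<in> R - core. E w u}" using free_core[OF assms] by auto
  then show ?thesis using deg[of w] free_not_S[OF assms] assms by (auto simp: free_def)
qed

text \<open>A centre outside \<open>S\<close> would have a neighbour missed by the copy, hence in
  \<open>free\<close>, against \<open>free_core\<close>. Consequently a copy within
  \<open>R - core\<close> would miss a vertex of \<open>S\<close>.\<close>

lemma root_in_core_S: "f (0, 0) \<in> core \<inter> S"
proof -
  note c = root_in_core
  moreover have "f (0,0) \<in> S"
  proof (rule ccontr)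
    assume "f (0,0) \<notin> S"
    then obtain u where "u \<in> R - f ` pos n k" "E (f (0,0)) u"
      using nbr_outside_image[OF f(1) subsetD[OF f(2) imageI[OF root_in_pos]]] by blast
    then show False using free_core[OF _ c] outside_free E_sym by blast
  qed
  ultimately show ?thesis by simp
qed

lemma card_trunk:
  "card {q \<in> trunk. even (snd q) \<longleftrightarrow> b} + card {q \<in> single. even (snd q) \<longleftrightarrow> b} + card long \<le> t"
proof -
  \<comment> \<open>The last two positions of a long leg have opposite parity; \<open>h l\<close> is
    the one of parity \<open>b\<close>.\<close>
  define h where "h l = (l, if even (k l) \<longleftrightarrow> b then k l else k l - 1)" for l
  have inj: "inj_on h long" by (auto simp: h_def inj_on_def)
  have k2: "2 \<le> k l" "l < n" if "l \<in> long" for l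
    using that cut_bounds(1)[of l] by (auto simp: long_def)
  have h: "h ` long \<subseteq> {q \<in> pos n k. even (snd q) \<longleftrightarrow> b}"
  proof
    fix q assume "q \<in> h ` long"
    then obtain l where l: "l \<in> long" "q = h l" by blast
    then show "q \<in> {q \<in> pos n k. even (snd q) \<longleftrightarrow> b}"
      using k2[of l] by (cases "even (k l) = b") (auto simp: h_def pos_def)
  qed
  let ?C = "\<lambda>A. {q \<in> A. even (snd q) \<longleftrightarrow> b}"
  have fin: "finite (?C (pos n k))" using finite_pos by simp
  have d: "?C trunk \<inter> ?C single = {}" "(?C trunk \<union> ?C single) \<inter> h ` long = {}"
    by (auto simp: trunk_def single_def h_def)
  have sub: "?C trunk \<subseteq> ?C (pos n k)" "?C single \<subseteq> ?C (pos n k)"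
    using single_pos by (auto simp: trunk_def)
  have "card (?C trunk) + card (?C single) + card (h ` long) = card (?C trunk \<union> ?C single \<union> h ` long)"
  proof -
    have "finite (?C trunk)" "finite (?C single)" "finite (h ` long)"
      using finite_subset[OF sub(1) fin] finite_subset[OF sub(2) fin] by auto
    then show ?thesis
      using d by (simp only: card_Un_disjoint finite_Un simp_thms)
  qed
  also have "\<dots> \<le> card (?C (pos n k))"
    using fin sub h by (intro card_mono) auto
  finally show ?thesis using class_le[of b] card_image[OF inj] by simp
qed

lemma col_f: "q \<in> pos n k \<Longrightarrow> col (f q) \<longleftrightarrow> (col (f (0, 0)) \<longleftrightarrow> even (snd q))"
  by (rule embeds_col[OF par_closed_pos order_refl f(1)])

text \<open>Of the \<open>t + 1\<close> neighbours off the core, those in the image of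
  \<open>single\<close> come from positions of parity \<open>b\<close>. By \<open>card_trunk\<close>
  the others exceed the trunk class plus one vertex per long leg.\<close>

lemma deg_free_pairs:
  assumes w: "w \<in> free" "col w \<noteq> (col (f (0, 0)) \<longleftrightarrow> b)"
  shows "card {q \<in> trunk. even (snd q) \<longleftrightarrow> b} + card long < card {u \<in> free \<union> (\<Union>l\<in>long. pair l). E w u}"
    (is "?T + _ < card ?N")
proof -
  have fin: "finite ?N" using finite_R by (auto simp: free_def pair_def)
  have "{u \<in> R - core. E w u} \<subseteq> ?N \<union> f ` {q \<in> single. even (snd q) \<longleftrightarrow> b}"
  proof
    fix u assume u: "u \<in> {u \<in> R - core. E w u}"
    show "u \<in> ?N \<union> f ` {q \<in> single. even (snd q) \<longleftrightarrow> b}"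
    proof (cases "u \<in> f ` single")
      case True
      then obtain q where q: "q \<in> single" "u = f q" by blast
      have "even (snd q) \<longleftrightarrow> b" using col_f[of q] single_pos q u w(2) E_col[of w u] by auto
      then show ?thesis using q by blast
    qed (use u in \<open>auto simp: free_def\<close>)
  qed
  then have "card {u \<in> R - core. E w u} \<le> card (?N \<union> f ` {q \<in> single. even (snd q) \<longleftrightarrow> b})"
    using fin finite_subset[OF single_pos finite_pos] by (intro card_mono) auto
  also have "\<dots> \<le> card ?N + card (f ` {q \<in> single. even (snd q) \<longleftrightarrow> b})"
    by (rule card_Un_le)
  also have "card (f ` {q \<in> single. even (snd q) \<longleftrightarrow> b}) \<le> card {q \<in> single. even (snd q) \<longleftrightarrow> b}"
    using finite_subset[OF single_pos finite_pos] by (intro card_image_le) auto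
  finally show ?thesis using card_trunk[of b] deg_off_core[OF w(1)] by linarith
qed

text \<open>The two vertices of a pair differ in colour, so \<open>w\<close> has at most one
  neighbour in each pair.\<close>

lemma deg_free:
  assumes w: "w \<in> free" "col w \<noteq> (col (f (0, 0)) \<longleftrightarrow> b)"
  shows "card {q \<in> trunk. even (snd q) \<longleftrightarrow> b} < card {u \<in> free. E w u}"
proof -
  define h where "h l = f (l, if even (cut l) \<longleftrightarrow> b then cut l else Suc (cut l))" for l
  have fin: "finite {u \<in> free. E w u}" using finite_R by (auto simp: free_def)
  have "{u \<in> free \<union> (\<Union>l\<in>long. pair l). E w u} \<subseteq> {u \<in> free. E w u} \<union> h ` long"
  proof
    fix u assume u: "u \<in> {u \<in> free \<union> (\<Union>l\<in>long. pair l). E w u}"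
    show "u \<in> {u \<in> free. E w u} \<union> h ` long"
    proof (cases "u \<in> free")
      case False
      then obtain l where l: "l \<in> long" "u \<in> pair l" using u by auto
      have "u = h l"
        using l(2) col_f[of "(l, cut l)"] col_f[of "(l, Suc (cut l))"] pair_pos[OF l(1)] u w(2) E_col[of w u]
        by (auto simp: pair_def h_def)
      then show ?thesis using l by blast
    qed (use u in auto)
  qed
  then have "card {u \<in> free \<union> (\<Union>l\<in>long. pair l). E w u} \<le> card ({u \<in> free. E w u} \<union> h ` long)"
    using fin by (intro card_mono) auto
  also have "\<dots> \<le> card {u \<in> free. E w u} + card (h ` long)" by (rule card_Un_le)
  also have "card (h ` long) \<le> card long" by (rule card_image_le) simp
  finally show ?thesis using deg_free_pairs[OF w] by linarith
qed

lemma trunk_closed: "par_closed trunk" "trunk \<subseteq> pos n k"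
proof -
  have "(0,0) \<in> trunk"
  proof -
    have "2 \<le> k l" if "l \<in> long" for l using that cut_bounds(1)[of l] by (auto simp: long_def)
    then show ?thesis using k_pos by (fastforce simp: trunk_def single_def)
  qed
  moreover have "par q \<in> trunk" if q: "q \<in> trunk" for q
  proof (cases "snd q \<le> 1")
    case True
    then show ?thesis using \<open>(0,0) \<in> trunk\<close> by (simp add: par_def)
  next
    case False
    then obtain l p where lp: "q = (l, p)" "2 \<le> p" "p \<le> k l" "l < n"
      using q by (auto simp: trunk_def pos_def)
    then show ?thesis using q False by (auto simp: trunk_def par_def pos_def single_def)
  qed
  ultimately show "par_closed trunk" by (simp add: par_closed_def)
qed (auto simp: trunk_def)

text \<open>Keeping the colour of the old centre makes the parity classes fit the degree
  bounds.\<close>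

lemma trunk_embedding:
  obtains g where "embeds trunk g" "g ` trunk \<subseteq> free" "col (g (0, 0)) = col (f (0, 0))"
proof -
  \<comment> \<open>If \<open>x0\<close> has the wrong colour, it is replaced by a neighbour that
    the copy also misses.\<close>
  obtain z where z: "z \<in> R - f ` pos n k" "col z = col (f (0,0))"
  proof (cases "col x0 = col (f (0,0))")
    case False
    have "x0 \<notin> S" using x0 contains_S[OF f] by auto
    then obtain u where "u \<in> R - f ` pos n k" "E x0 u"
      using nbr_outside_image[OF f(1), of x0] x0 by auto
    then show ?thesis using that[of u] E_col[of x0 u] False by auto
  qed (use that x0 in blast)
  let ?Q = "{(0, 0)}" and ?g = "\<lambda>_. z"
  have zF: "z \<in> free" using z outside_free by auto
  then have A: "free \<union> ?g ` ?Q = free" by auto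
  have "\<exists>h. embeds trunk h \<and> (\<forall>q\<in>?Q. h q = ?g q) \<and> h ` (trunk - ?Q) \<subseteq> free"
  proof (rule extend_embedding[where W = free])
    fix w b assume "w \<in> free" "col w \<noteq> (col z \<longleftrightarrow> b)"
    then show "card {q \<in> trunk. even (snd q) = b} \<le> card {u \<in> free \<union> ?g ` ?Q. E w u}"
      unfolding A using deg_free[of w b] z(2) by simp
  qed (use zF trunk_closed in \<open>auto simp: par_closed_def par_def embeds_def\<close>)
  then obtain h where h: "embeds trunk h" "\<forall>q\<in>?Q. h q = ?g q" "h ` (trunk - ?Q) \<subseteq> free" by blast
  have "h ` trunk \<subseteq> free" using image_extension[OF h(2,3)] A by simp
  then show thesis using that h(1,2) z(2) by simp
qed

text \<open>
  The trunk is embedded in \<open>free\<close>, and the long legs in \<open>M\<close> have received their last but one vertex.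
  If no vertex of \<open>free\<close> was available for it, it was taken from an untouched pair, whose other vertex
  then served as the end of the leg at once. So each leg in \<open>M\<close> costs at most one vertex per class,
  counting touched pairs entirely.
\<close>

definition stage ::
  "nat set \<Rightarrow> (nat \<times> nat) set \<Rightarrow> (nat \<times> nat \<Rightarrow> 'c) \<Rightarrow> nat set \<Rightarrow> bool" where
  "stage M Q g B \<longleftrightarrow> par_closed Q \<and> trunk \<subseteq> Q \<and>
     Q \<subseteq> trunk \<union> {(l, p) |l p. l \<in> M \<and> (p = k l \<or> p = k l - 1)} \<and>
     (\<forall>l\<in>M. (l, k l - 1) \<in> Q \<and> ((l, k l) \<notin> Q \<longrightarrow> g (l, k l - 1) \<in> free)) \<and>
     embeds Q g \<and> g ` trunk \<subseteq> free \<and> col (g (0, 0)) = col (f (0, 0)) \<and>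
     B \<subseteq> long \<and> g ` Q \<subseteq> free \<union> (\<Union>l\<in>B. pair l) \<and>
     (\<forall>c. card {u \<in> g ` Q \<union> (\<Union>l\<in>B. pair l). col u = c}
        \<le> card {q \<in> trunk. even (snd q) \<longleftrightarrow> (c \<longleftrightarrow> col (f (0, 0)))} + card M)"

section \<open>Placing the last but one vertices of the long legs\<close>

lemma pair_disjoint:
  assumes "l \<in> long" "l' \<in> long" "l \<noteq> l'"
  shows "pair l \<inter> pair l' = {}"
proof -
  have "q \<noteq> q' \<Longrightarrow> q \<in> pos n k \<Longrightarrow> q' \<in> pos n k \<Longrightarrow> f q \<noteq> f q'" for q q'
    using inj_f by (auto dest: inj_onD)
  then show ?thesis using pair_pos[OF assms(1)] pair_pos[OF assms(2)] assms(3)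
    by (simp add: pair_def)
qed

lemma pair_free: "l \<in> long \<Longrightarrow> pair l \<inter> free = {}"
  by (auto simp: free_def)

lemma pair_partner:
  assumes "l \<in> long" "u \<in> pair l"
  obtains u' where "pair l = {u, u'}" "E u u'"
proof -
  have "par (l, Suc (cut l)) = (l, cut l)" using cut_bounds(1)[of l] by (simp add: par_leg at_leg_def)
  moreover have "(l, Suc (cut l)) \<in> pos n k" using pair_pos[OF assms(1)] by simp
  ultimately have "E (f (l, cut l)) (f (l, Suc (cut l)))"
    using f(1) by (fastforce simp: embeds_def)
  then show thesis using that assms(2) E_sym by (fastforce simp: pair_def)
qed

lemma finite_pairs [simp]: "finite (pair l)"
  by (simp add: pair_def)

lemma finite_trunk [simp]: "finite trunk"
  using finite_subset[OF trunk_closed(2) finite_pos] .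

lemma long_ends:
  assumes "l \<in> long"
  shows "2 \<le> k l" "l < n" "(l, k l) \<in> pos n k" "(l, k l - 1) \<in> pos n k" "(l, k l) \<notin> trunk"
    "(l, k l - 1) \<notin> trunk" "par (l, k l) = (l, k l - 1)" "par (l, k l - 1) \<in> trunk"
proof -
  show k: "2 \<le> k l" "l < n" using assms cut_bounds(1)[of l] by (auto simp: long_def)
  then show pos: "(l, k l) \<in> pos n k" "(l, k l - 1) \<in> pos n k" by (auto simp: pos_def)
  show "(l, k l) \<notin> trunk" "(l, k l - 1) \<notin> trunk" using assms by (auto simp: trunk_def)
  show "par (l, k l) = (l, k l - 1)" using k by (simp add: par_def)
  show "par (l, k l - 1) \<in> trunk"
  proof (cases "k l = 2")
    case True
    then show ?thesis using trunk_closed(1) by (simp add: par_def par_closed_def)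
  next
    case False
    then show ?thesis using k assms by (auto simp: par_def trunk_def pos_def single_def)
  qed
qed

lemma trunk_ends_pos:
  "M \<subseteq> long \<Longrightarrow> trunk \<union> {(l, p) |l p. l \<in> M \<and> (p = k l \<or> p = k l - 1)} \<subseteq> pos n k"
  using trunk_closed(2) long_ends(3,4) by blast

text \<open>Applied with \<open>D\<close> a single new vertex or a newly touched pair.\<close>

lemma card_colour_add:
  assumes "X \<subseteq> Y \<union> D" "finite Y" "finite D" "\<And>u v. u \<in> D \<Longrightarrow> v \<in> D \<Longrightarrow> col u = col v \<Longrightarrow> u = v"
  shows "card {u \<in> X. col u = c} \<le> Suc (card {u \<in> Y. col u = c})"
proof -
  have "card {u \<in> D. col u = c} \<le> 1"
    using assms(3,4) by (subst One_nat_def, subst card_le_Suc0_iff_eq) auto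
  moreover have "card {u \<in> X. col u = c} \<le> card ({u \<in> Y. col u = c} \<union> {u \<in> D. col u = c})"
    using assms(1-3) by (intro card_mono) auto
  ultimately show ?thesis
    using card_Un_le[of "{u \<in> Y. col u = c}" "{u \<in> D. col u = c}"] by linarith
qed

lemma stage_base:
  assumes "embeds trunk g" "g ` trunk \<subseteq> free" "col (g (0, 0)) = col (f (0, 0))"
  shows "stage {} trunk g {}"
proof -
  have "card {u \<in> g ` trunk. col u = c} \<le> card {q \<in> trunk. even (snd q) \<longleftrightarrow> (c \<longleftrightarrow> col (f (0, 0)))}" for c
  proof (rule surj_card_le[where f = g])
    show "{u \<in> g ` trunk. col u = c} \<subseteq> g ` {q \<in> trunk. even (snd q) \<longleftrightarrow> (c \<longleftrightarrow> col (f (0, 0)))}"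
      using embeds_col[OF trunk_closed assms(1)] assms(3) by auto
  qed simp
  then show ?thesis using assms trunk_closed by (auto simp: stage_def)
qed

lemma stage_step:
  assumes st: "stage M Q g B" and l: "l \<in> long - M" and M: "M \<subseteq> long"
  shows "\<exists>Q g B. stage (insert l M) Q g B"
proof -
  have Q: "par_closed Q" "trunk \<subseteq> Q"
    "Q \<subseteq> trunk \<union> {(l, p) |l p. l \<in> M \<and> (p = k l \<or> p = k l - 1)}"
    and QM: "\<And>l. l \<in> M \<Longrightarrow> (l, k l - 1) \<in> Q"
      "\<And>l. l \<in> M \<Longrightarrow> (l, k l) \<notin> Q \<Longrightarrow> g (l, k l - 1) \<in> free"
    and g: "embeds Q g" "g ` trunk \<subseteq> free" "col (g (0, 0)) = col (f (0, 0))"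
    and B: "B \<subseteq> long" "g ` Q \<subseteq> free \<union> (\<Union>l\<in>B. pair l)"
    and cnt: "\<And>c. card {u \<in> g ` Q \<union> (\<Union>l\<in>B. pair l). col u = c}
        \<le> card {q \<in> trunk. even (snd q) \<longleftrightarrow> (c \<longleftrightarrow> col (f (0, 0)))} + card M"
    using st unfolding stage_def by blast+
  have Qpos: "Q \<subseteq> pos n k"
    using Q(3) trunk_ends_pos[OF M] by blast
  then have finQ: "finite Q" using finite_pos finite_subset by blast
  have finB: "finite B" using finite_subset[OF B(1)] by simp
  have fin: "finite (g ` Q \<union> (\<Union>l\<in>B. pair l))" using finQ finB by simp
  have lL: "l \<in> long" "l \<notin> M" using l by auto
  note ends = long_ends[OF lL(1)]
  have new: "(l, k l - 1) \<notin> Q" "(l, k l) \<notin> Q" using ends(5,6) Q(3) lL by auto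
  let ?v = "(l, k l - 1)" and ?v' = "(l, k l)"
  let ?w = "g (par ?v)"
  have w: "?w \<in> free" "par ?v \<in> Q" using ends(8) g(2) Q(2) by auto
  define c where "c = (\<not> col ?w)"
  let ?b = "c \<longleftrightarrow> col (f (0, 0))"
  let ?N = "{u \<in> free \<union> (\<Union>l\<in>long. pair l). E ?w u}"
  let ?Y = "g ` Q \<union> (\<Union>l\<in>B. pair l)"
  \<comment> \<open>Not all long legs are treated yet, so by \<open>cnt\<close> some neighbour of
    \<open>?w\<close> is neither used nor in a touched pair.\<close>
  have "card M < card long" using lL M by (intro psubset_card_mono) auto
  moreover have "card {q \<in> trunk. even (snd q) \<longleftrightarrow> ?b} + card long < card ?N"
    by (rule deg_free_pairs[OF w(1)]) (auto simp: c_def)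
  ultimately have "card {u \<in> ?Y. col u = c} < card ?N" using cnt[of c] by linarith
  then have "\<not> ?N \<subseteq> {u \<in> ?Y. col u = c}"
    using card_mono[OF finite_subset[OF _ fin], of "{u \<in> ?Y. col u = c}" ?N] by fastforce
  then obtain u where u: "u \<in> free \<union> (\<Union>l\<in>long. pair l)" "E ?w u" "u \<notin> ?Y"
    using E_col[of ?w] by (auto simp: c_def)
  define g1 where "g1 = g(?v := u)"
  define Q1 where "Q1 = insert ?v Q"
  have e1: "embeds Q1 g1" "par_closed Q1"
    using embeds_insert[OF Q(1) g(1) new(1) w(2) _ u(2)] u(3) by (auto simp: g1_def Q1_def)
  have g1Q: "g1 q = g q" if "q \<in> Q" for q using that new by (auto simp: g1_def)
  have im1: "g1 ` Q1 = insert u (g ` Q)" 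
  proof -
    have "g1 ` Q = g ` Q" using g1Q by (intro image_cong) auto
    then show ?thesis unfolding Q1_def image_insert by (simp add: g1_def)
  qed
  have trunk1: "g1 ` trunk \<subseteq> free" "col (g1 (0,0)) = col (f (0,0))"
  proof -
    have "g1 ` trunk = g ` trunk" using g1Q Q(2) by (intro image_cong) auto
    then show "g1 ` trunk \<subseteq> free" using g(2) by simp
    show "col (g1 (0,0)) = col (f (0,0))" using g(3) g1Q Q(1) by (auto simp: par_closed_def)
  qed
  have cM: "card (insert l M) = Suc (card M)" using lL M finite_subset[OF M] by simp
  show ?thesis
  proof (cases "u \<in> free")
    case True
    have le: "card {x \<in> g1 ` Q1 \<union> (\<Union>l\<in>B. pair l). col x = c} \<le> Suc (card {x \<in> ?Y. col x = c})" for c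
      by (rule card_colour_add[where D = "{u}"]) (use im1 fin in auto)
    have "card {x \<in> g1 ` Q1 \<union> (\<Union>l\<in>B. pair l). col x = c}
        \<le> card {q \<in> trunk. even (snd q) \<longleftrightarrow> (c \<longleftrightarrow> col (f (0, 0)))} + card (insert l M)" for c
      unfolding cM using cnt[of c] le[of c] by linarith
    moreover have "g1 (m, k m - 1) \<in> free" if "m \<in> insert l M" "(m, k m) \<notin> Q1" for m
    proof (cases "m = l")
      case False
      then show ?thesis using that QM g1Q[of "(m, k m - 1)"] by (auto simp: Q1_def)
    qed (use True in \<open>simp add: g1_def\<close>)
    moreover have "(m, k m - 1) \<in> Q1" if "m \<in> insert l M" for m
      using that QM by (auto simp: Q1_def)
    moreover have "g1 ` Q1 \<subseteq> free \<union> (\<Union>l\<in>B. pair l)" using im1 True B by auto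
    moreover have "Q1 \<subseteq> trunk \<union> {(m, p) |m p. m \<in> insert l M \<and> (p = k m \<or> p = k m - 1)}"
      using Q(3) by (auto simp: Q1_def)
    moreover have "trunk \<subseteq> Q1" using Q(2) by (auto simp: Q1_def)
    ultimately have "stage (insert l M) Q1 g1 B"
      unfolding stage_def using e1 trunk1 B(1) by blast
    then show ?thesis by (intro exI)
  next
    case False
    then obtain m where m: "m \<in> long" "u \<in> pair m" using u(1) by blast
    then have mB: "m \<notin> B" using u(3) by blast
    from pair_partner[OF m] obtain u' where u': "pair m = {u, u'}" "E u u'" .
    \<comment> \<open>The whole pair is new: it is disjoint from \<open>free\<close> and from the
      touched pairs.\<close>
    have "pair m \<inter> ?Y = {}"
      using B pair_free[OF m(1)] pair_disjoint[OF m(1)] mB by fast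
    then have u'Q: "u' \<notin> g1 ` Q1" using im1 u' E_col[OF u'(2)] by auto
    define g2 where "g2 = g1(?v' := u')"
    define Q2 where "Q2 = insert ?v' Q1"
    have new2: "?v' \<notin> Q1" using new ends(1) by (auto simp: Q1_def)
    have "g1 (par ?v') = u" using ends(7) by (simp add: g1_def)
    moreover have "par ?v' \<in> Q1" using ends(7) by (simp add: Q1_def)
    ultimately have e2: "embeds Q2 g2" "par_closed Q2"
      using embeds_insert[OF e1(2,1) new2 _ u'Q] u'(2) by (auto simp: g2_def Q2_def)
    have g2Q: "g2 q = g1 q" if "q \<in> Q1" for q using that new2 by (auto simp: g2_def)
    have im2: "g2 ` Q2 = insert u' (insert u (g ` Q))"
    proof -
      have "g2 ` Q1 = g1 ` Q1" using g2Q by (intro image_cong) auto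
      then show ?thesis unfolding Q2_def image_insert im1 by (simp add: g2_def)
    qed
    have trunk2: "g2 ` trunk \<subseteq> free" "col (g2 (0,0)) = col (f (0,0))"
    proof -
      have Q1: "trunk \<subseteq> Q1" "(0,0) \<in> Q1" using Q(2) e1(2) by (auto simp: Q1_def par_closed_def)
      have "g2 ` trunk = g1 ` trunk" using g2Q Q1(1) by (intro image_cong) auto
      then show "g2 ` trunk \<subseteq> free" using trunk1(1) by simp
      show "col (g2 (0,0)) = col (f (0,0))" using trunk1(2) g2Q[OF Q1(2)] by simp
    qed
    have le: "card {x \<in> g2 ` Q2 \<union> (\<Union>l\<in>insert m B. pair l). col x = c} \<le> Suc (card {x \<in> ?Y. col x = c})" for c
      by (rule card_colour_add[where D = "{u, u'}"]) (use im2 fin u' E_col[OF u'(2)] in auto)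
    have "card {x \<in> g2 ` Q2 \<union> (\<Union>l\<in>insert m B. pair l). col x = c}
        \<le> card {q \<in> trunk. even (snd q) \<longleftrightarrow> (c \<longleftrightarrow> col (f (0, 0)))} + card (insert l M)" for c
      unfolding cM using cnt[of c] le[of c] by linarith
    moreover have "g2 (m', k m' - 1) \<in> free" if "m' \<in> insert l M" "(m', k m') \<notin> Q2" for m'
    proof (cases "m' = l")
      case False
      then have "m' \<in> M" "(m', k m') \<notin> Q" using that by (auto simp: Q2_def Q1_def)
      then show ?thesis using QM[of m'] g1Q[of "(m', k m' - 1)"] g2Q[of "(m', k m' - 1)"]
        by (auto simp: Q1_def)
    qed (use that in \<open>simp add: Q2_def\<close>)
    moreover have "(m, k m - 1) \<in> Q2" if "m \<in> insert l M" for m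
      using that QM by (auto simp: Q2_def Q1_def)
    moreover have "g2 ` Q2 \<subseteq> free \<union> (\<Union>l\<in>insert m B. pair l)" using im2 u' B by auto
    moreover have "Q2 \<subseteq> trunk \<union> {(m, p) |m p. m \<in> insert l M \<and> (p = k m \<or> p = k m - 1)}"
      using Q(3) by (auto simp: Q1_def Q2_def)
    moreover have "trunk \<subseteq> Q2" using Q(2) by (auto simp: Q1_def Q2_def)
    moreover have "insert m B \<subseteq> long" using m B by auto
    ultimately have "stage (insert l M) Q2 g2 (insert m B)"
      unfolding stage_def using e2 trunk2 by blast
    then show ?thesis by (intro exI)
  qed
qed

lemma stage_complete: "\<exists>Q g B. stage long Q g B"
proof -
  obtain g where "embeds trunk g" "g ` trunk \<subseteq> free" "col (g (0, 0)) = col (f (0, 0))"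
    by (rule trunk_embedding)
  then have "stage {} trunk g {}" by (rule stage_base)
  moreover have "finite M \<Longrightarrow> M \<subseteq> long \<Longrightarrow> \<exists>Q g B. stage M Q g B" for M
  proof (induction M rule: finite_induct)
    case (insert l M)
    then obtain Q g B where "stage M Q g B" by blast
    then show ?case using stage_step[of M Q g B l] insert by auto
  qed (use \<open>stage {} trunk g {}\<close> in blast)
  ultimately show ?thesis by simp
qed

text \<open>The positions missing from \<open>Q\<close> are ends of legs whose parents are mapped
  into \<open>free\<close>. These parents have \<open>t + 1\<close> neighbours in
  \<open>R - core\<close>, so the copy can be completed there, avoiding the old centre although it
  belongs to \<open>S\<close>.\<close>

lemma absurd: False
proof -
  obtain Q g B where st: "stage long Q g B" using stage_complete by blast
  then have Q: "par_closed Q" "trunk \<subseteq> Q"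
    "Q \<subseteq> trunk \<union> {(l, p) |l p. l \<in> long \<and> (p = k l \<or> p = k l - 1)}"
    and QM: "\<And>l. l \<in> long \<Longrightarrow> (l, k l - 1) \<in> Q"
      "\<And>l. l \<in> long \<Longrightarrow> (l, k l) \<notin> Q \<Longrightarrow> g (l, k l - 1) \<in> free"
    and g: "embeds Q g" "g ` trunk \<subseteq> free"
    and B: "B \<subseteq> long" "g ` Q \<subseteq> free \<union> (\<Union>l\<in>B. pair l)"
    unfolding stage_def by blast+
  have Qpos: "Q \<subseteq> pos n k"
    using Q(3) trunk_ends_pos[of long] by blast
  have par_v: "par v \<in> Q \<and> g (par v) \<in> free" if v: "v \<in> pos n k - Q" for v
  proof -
    from v Q(2) have "v \<in> single \<or> (\<exists>l\<in>long. v = (l, k l))"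
      using QM(1) by (auto simp: trunk_def)
    then show ?thesis
    proof
      assume "v \<in> single"
      then obtain l where l: "v = (l, k l)" "l < n" "l \<notin> long" by (auto simp: single_def)
      have "par v \<in> trunk"
      proof (cases "k l = 1")
        case True
        then show ?thesis using l trunk_closed(1) by (simp add: par_def par_closed_def)
      next
        case False
        then show ?thesis using l k_pos[of l] by (auto simp: par_def trunk_def pos_def single_def)
      qed
      then show ?thesis using Q(2) g(2) by auto
    next
      assume "\<exists>l\<in>long. v = (l, k l)"
      then show ?thesis using QM long_ends(7) v by auto
    qed
  qed
  have finA: "finite (R - core \<union> g ` Q)"
    using finite_R finite_subset[OF Qpos finite_pos] by simp
  have "\<exists>h. embeds (pos n k) h \<and> (\<forall>q\<in>Q. h q = g q) \<and> h ` (pos n k - Q) \<subseteq> R - core"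
  \<comment> \<open>Every missing position has its parent in \<open>Q\<close>, so the second
    alternative applies and the new ends need not lie in \<open>free\<close>.\<close>
  proof (rule extend_embedding[where W = free])
    fix w b assume w: "w \<in> free"
    have "card {u \<in> R - core. E w u} \<le> card {u \<in> R - core \<union> g ` Q. E w u}"
      by (rule card_mono, rule finite_subset[OF _ finA]) auto
    then show "card {q \<in> pos n k. even (snd q) = b} \<le> card {u \<in> R - core \<union> g ` Q. E w u}"
      using deg_off_core[OF w] class_le[of b] by linarith
  qed (use par_v Q(1) Qpos g(1) in \<open>auto simp: par_closed_pos\<close>)
  then obtain h where h: "embeds (pos n k) h" "\<forall>q\<in>Q. h q = g q"
    "h ` (pos n k - Q) \<subseteq> R - core" by blast
  have "pair l \<subseteq> R - core" if l: "l \<in> long" for l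
  proof -
    have "f q \<notin> core" if q: "q = (l, cut l) \<or> q = (l, Suc (cut l))" for q
    proof
      assume "f q \<in> core"
      then obtain l' j where j: "f q = f (at_leg l' j)" "l' < n" "j < cut l'" by (auto simp: core_def)
      then have "at_leg l' j \<in> pos n k" using cut_bounds(3)[of l'] by (intro at_leg_pos) auto
      then have "q = at_leg l' j"
        using inj_onD[OF inj_f j(1)] pair_pos[OF l] q by auto
      then show False using j(3) q cut_bounds(1)[of l] by (auto simp: at_leg_def split: if_splits)
    qed
    then show ?thesis using f(2) pair_pos[OF l] by (auto simp: pair_def)
  qed
  then have "(\<Union>l\<in>B. pair l) \<subseteq> R - core" using B(1) by blast
  moreover have "free \<subseteq> R - core" by (auto simp: free_def)
  ultimately have "g ` Q \<subseteq> R - core" using B(2) by blast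
  then have "h ` pos n k \<subseteq> R - core" using image_extension[OF h(2,3)] by blast
  then show False using contains_S[OF h(1)] root_in_core_S by blast
qed

end

text \<open>For a copy that misses a vertex of \<open>R\<close>, either some leg meets
  \<open>S\<close> beyond the centre, refuted by \<open>absurd\<close>, or \<open>S\<close> is the
  centre alone, refuted by \<open>S_not_root\<close>.\<close>

lemma (in critical) critical_spanning:
  assumes "S \<noteq> {}" "embeds (pos n k) f" "f ` pos n k \<subseteq> R"
  shows "f ` pos n k = R"
proof (rule ccontr)
  assume "f ` pos n k \<noteq> R"
  then obtain x where x: "x \<in> R - f ` pos n k" 
    using assms(3) by (metis DiffI subset_antisym subsetI)
  show False
  proof (cases "\<exists>l<n. 1 \<le> last_S f l")
    case True
    then obtain l where "l < n" "1 \<le> last_S f l" by blast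
    then interpret critical_embedding V E col n k R S t f l x
      using assms x by unfold_locales auto
    show False by (rule absurd)
  next
    case False
    have "q = (0, 0)" if "q \<in> pos n k" "f q \<in> S" for q
    proof (rule ccontr)
      assume "q \<noteq> (0, 0)"
      then obtain l p where "q = (l, p)" "l < n" "1 \<le> p" "p \<le> k l" using \<open>q \<in> pos n k\<close> by (auto simp: pos_def)
      then show False using last_S(3)[of f l p] False that by auto
    qed
    then have "S = {f (0, 0)}" using contains_S[OF assms(2,3)] assms(1) by blast
    then show False using S_not_root[OF assms(2,3) x] by simp
  qed
qed

section \<open>Biconnected sets and ears\<close>

context host
begin

definition step :: "'c set \<Rightarrow> ('c \<times> 'c) set" where
  "step A = {(x, y). x \<in> A \<and> y \<in> A \<and> E x y}"

definition conn :: "'c set \<Rightarrow> bool" where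
  "conn A \<longleftrightarrow> A \<noteq> {} \<and> (\<forall>u\<in>A. \<forall>v\<in>A. (u, v) \<in> (step A)\<^sup>*)"

text \<open>A single vertex and an edge are biconnected in this sense; they start the growth of a block.\<close>

definition biconn :: "'c set \<Rightarrow> bool" where
  "biconn A \<longleftrightarrow> conn A \<and> (\<forall>v\<in>A. A = {v} \<or> conn (A - {v}))"

text \<open>Interior vertices may repeat, so shortcuts can be formed without checking simplicity;
  \<open>inj_interior\<close> recovers distinctness for shortest ears.\<close>

definition ear :: "'c set \<Rightarrow> nat \<Rightarrow> (nat \<Rightarrow> 'c) \<Rightarrow> bool" where
  "ear D r p \<longleftrightarrow> 2 \<le> r \<and> p 0 \<in> D \<and> p r \<in> D \<and> p 0 \<noteq> p r \<and>
     (\<forall>i<r. E (p i) (p (Suc i))) \<and> (\<forall>i. 0 < i \<longrightarrow> i < r \<longrightarrow> p i \<notin> D)"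

lemma E_irrefl: "\<not> E v v"
  using E_col by blast

lemma conn_singleton: "conn {x}"
  by (simp add: conn_def)

lemma step_mono: "A \<subseteq> B \<Longrightarrow> step A \<subseteq> step B"
  by (auto simp: step_def)

lemma conn_insert:
  assumes "conn A" "a \<in> A" "E a x"
  shows "conn (insert x A)"
proof -
  let ?S = "step (insert x A)"
  have A: "(u, v) \<in> ?S\<^sup>*" if "u \<in> A" "v \<in> A" for u v
    using assms(1) that rtrancl_mono[OF step_mono[of A "insert x A"]] by (auto simp: conn_def)
  have ax: "(a, x) \<in> ?S" "(x, a) \<in> ?S" using assms E_sym by (auto simp: step_def)
  have "(u, v) \<in> ?S\<^sup>*" if "u \<in> insert x A" "v \<in> insert x A" for u v
  proof -
    have "(u, a) \<in> ?S\<^sup>*" using that(1) A assms(2) ax(2) by blast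
    moreover have "(a, v) \<in> ?S\<^sup>*" using that(2) A assms(2) ax(1) by blast
    ultimately show ?thesis by (rule rtrancl_trans)
  qed
  then show ?thesis by (simp add: conn_def)
qed

text \<open>Deleting a vertex from an ear leaves pieces attached to \<open>D\<close> at their start
  or, after reversal in \<open>conn_suffix\<close>, at their end.\<close>

lemma conn_prefix:
  assumes "conn A" "p 0 \<in> A" "\<And>i. i < m \<Longrightarrow> E (p i) (p (Suc i))"
  shows "conn (A \<union> p ` {..m})"
  using assms(3)
proof (induction m)
  case 0
  have "A \<union> p ` {..0} = A" using assms(2) by auto
  then show ?case using assms(1) by simp
next
  case (Suc m)
  have "A \<union> p ` {..Suc m} = insert (p (Suc m)) (A \<union> p ` {..m})"
    by (auto simp: atMost_Suc)
  then show ?case using conn_insert[of "A \<union> p ` {..m}" "p m" "p (Suc m)"] Suc by auto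
qed

lemma conn_suffix:
  assumes "conn A" "p r \<in> A" "m \<le> r" "\<And>i. m \<le> i \<Longrightarrow> i < r \<Longrightarrow> E (p i) (p (Suc i))"
  shows "conn (A \<union> p ` {m..r})"
proof -
  have "E (p (r - i)) (p (r - Suc i))" if "i < r - m" for i
    using assms(4)[of "r - Suc i"] that E_sym by (simp add: Suc_diff_Suc)
  then have "conn (A \<union> (\<lambda>i. p (r - i)) ` {..r - m})"
    using assms by (intro conn_prefix) auto
  moreover have "(\<lambda>i. p (r - i)) ` {..r - m} = p ` {m..r}"
  proof -
    have "(\<lambda>i. r - i) ` {..r - m} = {m..r}"
    proof
      show "{m..r} \<subseteq> (\<lambda>i. r - i) ` {..r - m}"
      proof
        fix x assume "x \<in> {m..r}"
        then show "x \<in> (\<lambda>i. r - i) ` {..r - m}" by (intro image_eqI[of _ _ "r - x"]) auto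
      qed
    qed (use assms(3) in auto)
    then show ?thesis by (metis image_image)
  qed
  ultimately show ?thesis by simp
qed

text \<open>After deleting a vertex of \<open>D\<close>, the ear is still attached at an end
  different from it. After deleting an interior vertex, both remaining pieces are attached at one
  end each; injectivity ensures that only one index disappears.\<close>

lemma biconn_add_ear:
  assumes D: "biconn D" and p: "ear D r p" and inj: "inj_on p {0<..<r}"
  shows "biconn (D \<union> p ` {0<..<r})"
proof -
  let ?U = "D \<union> p ` {0<..<r}"
  have r: "2 \<le> r" and ends: "p 0 \<in> D" "p r \<in> D" "p 0 \<noteq> p r"
    and E: "\<And>i. i < r \<Longrightarrow> E (p i) (p (Suc i))" and int: "\<And>i. 0 < i \<Longrightarrow> i < r \<Longrightarrow> p i \<notin> D"
    using p by (auto simp: ear_def)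
  have "conn (D \<union> p ` {..r - 1})"
    using D ends E r by (intro conn_prefix) (auto simp: biconn_def)
  moreover have "D \<union> p ` {..r - 1} = ?U"
  proof -
    have "{..r - 1} = insert 0 {0<..<r}" using r by auto
    then show ?thesis using ends by auto
  qed
  ultimately have "conn ?U" by simp
  moreover have "conn (?U - {v})" if v: "v \<in> ?U" for v
  proof (cases "v \<in> D")
    case True
    then have c: "conn (D - {v})" using D ends by (auto simp: biconn_def)
    show ?thesis
    proof (cases "v = p 0")
      case True
      then have "conn (D - {v} \<union> p ` {1..r})"
        using c ends E r by (intro conn_suffix) auto
      moreover have "D - {v} \<union> p ` {1..r} = ?U - {v}"
      proof -
        have "{1..r} = insert r {0<..<r}" using r by auto
        then show ?thesis using ends int True by auto
      qed
      ultimately show ?thesis by simp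
    next
      case False
      then have "conn (D - {v} \<union> p ` {..r - 1})"
        using c ends E r by (intro conn_prefix) auto
      moreover have "D - {v} \<union> p ` {..r - 1} = ?U - {v}"
      proof -
        have "{..r - 1} = insert 0 {0<..<r}" using r by auto
        then show ?thesis using ends int True False by auto
      qed
      ultimately show ?thesis by simp
    qed
  next
    case False
    then obtain i where i: "v = p i" "0 < i" "i < r" using v by auto
    have "conn (D \<union> p ` {..i - 1})"
      using D ends E i by (intro conn_prefix) (auto simp: biconn_def)
    then have "conn (D \<union> p ` {..i - 1} \<union> p ` {Suc i..r})"
      using ends E i by (intro conn_suffix) auto
    moreover have "D \<union> p ` {..i - 1} \<union> p ` {Suc i..r} = ?U - {v}"
    proof -
      have *: "{0<..<r} - {i} \<union> {0, r} = {..i - 1} \<union> {Suc i..r}" using i by auto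
      have "p ` ({0<..<r} - {i}) = p ` {0<..<r} - {v}"
        using inj_on_image_set_diff[OF inj, of "{0<..<r}" "{i}"] i by auto
      then have "?U - {v} = D \<union> p ` ({0<..<r} - {i} \<union> {0, r})"
        using ends False by auto
      then show ?thesis unfolding * by (simp add: image_Un Un_assoc)
    qed
    ultimately show ?thesis by simp
  qed
  ultimately show ?thesis by (simp add: biconn_def)
qed

lemma exit_edge:
  assumes "(u, v) \<in> (step A)\<^sup>*" "u \<in> D" "v \<notin> D"
  obtains x y where "x \<in> D" "y \<notin> D" "y \<in> A" "E x y"
  using assms by (induction arbitrary: thesis rule: rtrancl_induct) (auto simp: step_def)

text \<open>Some edge leaves \<open>D\<close> at a vertex \<open>d\<close>. As
  \<open>V - {d}\<close> is connected, a walk leads from its outer end to another vertex of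
  \<open>D\<close>; it is stopped at its first vertex in \<open>D\<close>.\<close>

lemma ear_exists:
  assumes "biconn V" "D \<subset> V" "d1 \<in> D" "d2 \<in> D" "d1 \<noteq> d2"
  shows "\<exists>r p. ear D r p"
proof -
  obtain y where "y \<in> V" "y \<notin> D" using assms(2) by blast
  then have "(d1, y) \<in> (step V)\<^sup>*" using assms by (auto simp: biconn_def conn_def)
  then obtain d x where d: "d \<in> D" "x \<notin> D" "x \<in> V" "E d x"
    using exit_edge assms(3) \<open>y \<notin> D\<close> by metis
  obtain d' where d': "d' \<in> D" "d' \<noteq> d" using assms(3-5) by metis
  have "conn (V - {d})" using assms(1,2) d d' by (auto simp: biconn_def)
  then have "(x, d') \<in> (step (V - {d}))\<^sup>*"
    using d d' assms(2) by (auto simp: conn_def)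
  then obtain m where "(x, d') \<in> step (V - {d}) ^^ m" using rtrancl_imp_relpow by blast
  then obtain q where q: "q 0 = x" "q m = d'" "\<And>i. i < m \<Longrightarrow> (q i, q (Suc i)) \<in> step (V - {d})"
    unfolding relpow_fun_conv by blast
  define s where "s = (LEAST i. q i \<in> D)"
  have s: "q s \<in> D" "s \<le> m" "\<And>i. i < s \<Longrightarrow> q i \<notin> D"
    using d'(1) q(2) by (auto simp: s_def intro: LeastI Least_le dest: not_less_Least)
  have s0: "0 < s" using s(1) q(1) d(2) by (cases s) auto
  have qs: "q s \<noteq> d" using q(3)[of "s - 1"] s s0 by (auto simp: step_def)
  let ?p = "\<lambda>i. if i = 0 then d else q (i - 1)"
  have "E (?p i) (?p (Suc i))" if "i < Suc s" for i
    using that d(4) q(1) q(3)[of "i - 1"] s(2) by (cases i) (auto simp: step_def)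
  then have "ear D (Suc s) ?p"
    using s s0 qs d by (auto simp: ear_def)
  then show ?thesis by blast
qed

end

section \<open>Shortest ears and the neighbours of vertices outside \<open>D\<close>\<close>

locale shortest_ear = host V E col
  for V :: "'c set" and E :: "'c \<Rightarrow> 'c \<Rightarrow> bool" and col :: "'c \<Rightarrow> bool" +
  fixes D :: "'c set" and r :: nat and p :: "nat \<Rightarrow> 'c"
  assumes ear: "ear D r p" and shortest: "ear D r' p' \<Longrightarrow> r \<le> r'"
begin

lemma ear_props:
  "2 \<le> r" "p 0 \<in> D" "p r \<in> D" "p 0 \<noteq> p r" "i < r \<Longrightarrow> E (p i) (p (Suc i))"
  "0 < i \<Longrightarrow> i < r \<Longrightarrow> p i \<notin> D"
  using ear by (auto simp: ear_def)

text \<open>Cutting out the closed piece between two occurrences of a vertex would shorten the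
  ear.\<close>

lemma inj_interior: "inj_on p {0<..<r}"
proof -
  have "p i \<noteq> p j" if ij: "0 < i" "i < j" "j < r" for i j
  proof
    assume eq: "p i = p j"
    let ?q = "\<lambda>m. if m \<le> i then p m else p (m + (j - i))"
    have "E (?q m) (?q (Suc m))" if "m < r - (j - i)" for m
      using ear_props(5)[of m] ear_props(5)[of "m + (j - i)"] that ij eq
      by (cases m i rule: linorder_cases) auto
    moreover have "?q m \<notin> D" if "0 < m" "m < r - (j - i)" for m
      using ear_props(6)[of m] ear_props(6)[of "m + (j - i)"] that ij by auto
    ultimately have "ear D (r - (j - i)) ?q"
      using ear_props(1-4) ij unfolding ear_def by auto
    then show False using shortest ij by fastforce
  qed
  then show ?thesis by (intro linorder_inj_onI') auto
qed

text \<open>A chord would shorten the ear. The vertex \<open>p 1\<close> later serves to find a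
  vertex outside \<open>D\<close> and the ear.\<close>

lemma no_chord: "1 + 2 \<le> j \<Longrightarrow> j < r \<Longrightarrow> \<not> E (p 1) (p j)"
proof
  assume j: "1 + 2 \<le> j" "j < r" and e: "E (p 1) (p j)"
  then have jj: "Suc (Suc (j - 2)) = j" by simp
  let ?q = "\<lambda>m. if m \<le> 1 then p m else p (m + (j - 2))"
  have "E (?q m) (?q (Suc m))" if "m < r - (j - 2)" for m
    using ear_props(5)[of 0] ear_props(5)[of "m + (j - 2)"] that j e jj
    by (cases m "1::nat" rule: linorder_cases) auto
  moreover have "?q m \<notin> D" if "0 < m" "m < r - (j - 2)" for m
    using ear_props(6)[of m] ear_props(6)[of "m + (j - 2)"] that j by auto
  ultimately have "ear D (r - (j - 2)) ?q"
    using ear_props(1-4) j unfolding ear_def by auto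
  then show False using shortest j by fastforce
qed

text \<open>A detour through \<open>x\<close> replaces \<open>j - i\<close> edges by two, so
  \<open>j - i\<close> is at most 2; the colouring excludes 1.\<close>

lemma outside_nbrs_close:
  assumes x: "x \<notin> D" "E x (p i)" "E x (p j)" and ij: "i < j" "j < r"
  shows "j = i + 2"
proof (rule ccontr)
  assume "j \<noteq> i + 2"
  moreover have "j \<noteq> Suc i" using E_col[OF x(2)] E_col[OF x(3)] E_col[OF ear_props(5)[of i]] ij by auto
  ultimately have j: "i + 3 \<le> j" using ij by simp
  then have jj: "Suc (Suc (j - 2)) = j" by simp
  let ?q = "\<lambda>m. if m \<le> i then p m else if m = Suc i then x else p (m + (j - i - 2))"
  have "E (?q m) (?q (Suc m))" if m: "m < r - (j - i - 2)" for m
  proof -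
    consider "m < i" | "m = i" | "m = Suc i" | "Suc i < m" by linarith
    then show ?thesis
      using ear_props(5)[of m] ear_props(5)[of "m + (j - i - 2)"] m j ij x E_sym jj
      by cases auto
  qed
  moreover have "?q m \<notin> D" if "0 < m" "m < r - (j - i - 2)" for m
    using ear_props(6)[of m] ear_props(6)[of "m + (j - i - 2)"] that j ij x by auto
  ultimately have "ear D (r - (j - i - 2)) ?q"
    using ear_props(1-4) j ij unfolding ear_def by auto
  then show False using shortest j ij by fastforce
qed

text \<open>The competing ears run from \<open>d\<close> through \<open>x\<close> and
  \<open>p i\<close> to \<open>p r\<close>, with length \<open>r + 2 - i\<close>, and from
  \<open>p 0\<close> through \<open>p i\<close> and \<open>x\<close> to \<open>d\<close>, with
  length \<open>i + 2\<close>.\<close>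

lemma outside_nbr_D:
  assumes x: "x \<notin> D" "E x (p i)" "E x d" and i: "0 < i" "i < r" and d: "d \<in> D"
  shows "d \<noteq> p r \<Longrightarrow> i \<le> 2" "d \<noteq> p 0 \<Longrightarrow> r \<le> i + 2"
proof -
  assume dr: "d \<noteq> p r"
  let ?q = "\<lambda>m. if m = 0 then d else if m = 1 then x else p (m - 2 + i)"
  have "E (?q m) (?q (Suc m))" if m: "m < r + 2 - i" for m
  proof -
    consider "m = 0" | "m = 1" | m' where "m = Suc (Suc m')"
      by (metis One_nat_def not0_implies_Suc)
    then show ?thesis using ear_props(5)[of "m - 2 + i"] m x E_sym i
      by cases auto
  qed
  moreover have "?q m \<notin> D" if "0 < m" "m < r + 2 - i" for m
  proof (cases "m = 1")
    case False
    then have "m - 2 + i < r" "0 < m - 2 + i" using that i by linarith+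
    then show ?thesis using ear_props(6)[of "m - 2 + i"] that False by simp
  qed (use x in simp)
  moreover have "r + 2 - i - 2 + i = r" "2 \<le> r + 2 - i" using i by linarith+
  ultimately have "ear D (r + 2 - i) ?q"
    using ear_props(3) dr i d unfolding ear_def by auto
  then show "i \<le> 2" using shortest i by fastforce
next
  assume d0: "d \<noteq> p 0"
  let ?q = "\<lambda>m. if m \<le> i then p m else if m = Suc i then x else d"
  have "E (?q m) (?q (Suc m))" if m: "m < i + 2" for m
  proof -
    consider "m < i" | "m = i" | "m = Suc i" using m by linarith
    then show ?thesis using ear_props(5)[of m] x E_sym i by cases auto
  qed
  moreover have "?q m \<notin> D" if "0 < m" "m < i + 2" for m
    using ear_props(6)[of m] that i x by auto
  ultimately have "ear D (i + 2) ?q"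
    using ear_props(1-4) d0 i d unfolding ear_def by auto
  then show "r \<le> i + 2" by (rule shortest)
qed

text \<open>Neighbours on the ear have indices among some \<open>i\<close> and \<open>i + 2\<close>,
  and a neighbour in \<open>D\<close> rules out having both.\<close>

lemma card_outside_nbrs:
  assumes x: "x \<notin> D" and one: "card {u \<in> D. E x u} \<le> 1" and fin: "finite D"
  shows "card {u \<in> D \<union> p ` {0<..<r}. E x u} \<le> 2"
proof -
  define J where "J = {i \<in> {0<..<r}. E x (p i)}"
  have finJ: "finite J" by (simp add: J_def)
  have close: "j = i + 2" if "i \<in> J" "j \<in> J" "i < j" for i j
    using outside_nbrs_close[of x i j] that x by (auto simp: J_def)
  have JM: "J \<subseteq> {Min J, Min J + 2}"
  proof
    fix j assume j: "j \<in> J"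
    then have "Min J \<in> J" "Min J \<le> j" using Min_in[OF finJ] Min_le[OF finJ j] by blast+
    then show "j \<in> {Min J, Min J + 2}" using close[of "Min J" j] j by (cases "Min J = j") auto
  qed
  have "card J \<le> card {Min J, Min J + 2}" by (rule card_mono[OF _ JM]) simp
  then have J2: "card J \<le> 2" by (simp add: card_insert_if)
  have J1: "card J \<le> 1" if d: "d \<in> D" "E x d" for d
  proof (rule ccontr)
    assume "\<not> card J \<le> 1"
    then obtain i j where ij: "i \<in> J" "j \<in> J" "i < j"
      using finJ by (metis One_nat_def card_le_Suc0_iff_eq linorder_neqE_nat)
    then have "j = i + 2" by (rule close)
    moreover have "0 < i" "i < r" "0 < j" "j < r" "E x (p i)" "E x (p j)"
      using ij by (auto simp: J_def)
    moreover from ear_props(4) have "d \<noteq> p 0 \<or> d \<noteq> p r" by auto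
    \<comment> \<open>If \<open>d \<noteq> p 0\<close>, then \<open>r \<le> i + 2 = j\<close>,
      against \<open>j < r\<close>; if \<open>d \<noteq> p r\<close>, then \<open>j \<le> 2\<close>,
      but \<open>0 < i\<close> gives \<open>3 \<le> j\<close>.\<close>
    ultimately show False
      using outside_nbr_D(2)[of x i d] outside_nbr_D(1)[of x j d] x d by auto
  qed
  have sub: "{u \<in> D \<union> p ` {0<..<r}. E x u} = {u \<in> D. E x u} \<union> p ` J"
    by (auto simp: J_def)
  have "card (p ` J) \<le> card J" by (rule card_image_le[OF finJ])
  moreover have "card ({u \<in> D. E x u} \<union> p ` J) \<le> card {u \<in> D. E x u} + card (p ` J)"
    by (rule card_Un_le)
  moreover have "card {u \<in> D. E x u} = 0 \<or> card J \<le> 1"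
  proof (cases "{u \<in> D. E x u} = {}")
    case True
    then show ?thesis by (simp only: card.empty simp_thms)
  next
    case False
    then show ?thesis using J1 by blast
  qed
  ultimately show ?thesis unfolding sub using J2 one by linarith
qed

end

section \<open>A nonseparating embedding\<close>

context spider_host
begin

lemma card_split_nbrs:
  assumes "D \<subseteq> V"
  shows "card {u \<in> V. E v u} = card {u \<in> D. E v u} + card {u \<in> V - D. E v u}"
proof -
  have "{u \<in> V. E v u} = {u \<in> D. E v u} \<union> {u \<in> V - D. E v u}" using assms by auto
  moreover have "finite {u \<in> D. E v u}" "finite {u \<in> V - D. E v u}"
    using finite_V finite_subset[OF assms] by auto
  ultimately show ?thesis by (simp add: card_Un_disjoint disjoint_iff)
qed

lemma nonseparating_embedding:
  assumes biconn: "biconn V"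
    and min_deg: "\<And>v. v \<in> V \<Longrightarrow> t + 2 \<le> card {u \<in> V. E v u}"
    and class_le: "\<And>b. card {q \<in> pos n k. even (snd q) \<longleftrightarrow> b} \<le> t"
    and k_pos: "\<And>l. l < n \<Longrightarrow> 1 \<le> k l"
  obtains f where "embeds (pos n k) f" "f ` pos n k \<subseteq> V" "biconn (V - f ` pos n k)"
    "3 \<le> card (V - f ` pos n k)"
proof -
  let ?P = "pos n k"
  have t1: "1 \<le> t"
  proof -
    have "{(0,0)} \<subseteq> {q \<in> ?P. even (snd q) \<longleftrightarrow> True}" by auto
    then have "card {(0::nat,0::nat)} \<le> card {q \<in> ?P. even (snd q) \<longleftrightarrow> True}"
      using finite_pos by (intro card_mono) auto
    then show ?thesis using class_le[of True] by simp
  qed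
  have outside: "2 \<le> card {u \<in> V - f ` ?P. E v u}" if "embeds ?P f" "f ` ?P \<subseteq> V" "v \<in> V" for f v
    using embeds_card_nbrs[OF that(1) class_le, of v] card_split_nbrs[OF that(2), of v]
      min_deg[OF that(3)] by linarith
  define good where
    "good D \<longleftrightarrow> D \<subseteq> V \<and> biconn D \<and> (\<exists>f. embeds ?P f \<and> f ` ?P \<subseteq> V - D)" for D
  obtain z where z: "z \<in> V" using biconn by (auto simp: biconn_def conn_def)
  have "\<exists>D. good D"
  proof -
    have "t \<le> card {u \<in> V. E w u}" if "w \<in> V" for w using min_deg[OF that] by simp
    then obtain g where g: "embeds ?P g" "g ` ?P \<subseteq> V"
      using greedy_embedding[OF z _ class_le] by blast
    have "0 < card {u \<in> V - g ` ?P. E z u}" using outside[OF g z] by linarith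
    then obtain y where "y \<in> V - g ` ?P" unfolding card_gt_0_iff by blast
    then have "good {y}" using g by (auto simp: good_def biconn_def conn_singleton)
    then show ?thesis ..
  qed
  moreover have "\<forall>D. good D \<longrightarrow> card D < Suc (card V)"
    using finite_V by (auto simp: good_def less_Suc_eq_le intro: card_mono)
  ultimately obtain D where D: "good D" and max: "\<And>D'. good D' \<Longrightarrow> card D' \<le> card D"
    using ex_has_greatest_nat[of good _ card "Suc (card V)"] by metis
  have DV: "D \<subseteq> V" and bD: "biconn D" using D by (auto simp: good_def)
  have finD: "finite D" using finite_subset[OF DV finite_V] .
  obtain f where f: "embeds ?P f" "f ` ?P \<subseteq> V - D" using D by (auto simp: good_def)
  have no_larger: False if "biconn D'" "D \<subset> D'" "D' \<subseteq> V" "embeds ?P g" "g ` ?P \<subseteq> V - D'" for D' g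
  proof -
    have "good D'" using that by (auto simp: good_def)
    moreover have "card D < card D'"
      using that finite_subset[OF that(3) finite_V] by (intro psubset_card_mono)
    ultimately show False using max by fastforce
  qed
  have "D = V - f ` ?P"
  proof (rule ccontr)
    assume ne: "D \<noteq> V - f ` ?P"
    have "D \<noteq> {}" using bD by (auto simp: biconn_def conn_def)
    then obtain d1 where d1: "d1 \<in> D" by blast
    \<comment> \<open>Ears need two distinct ends. A single vertex could be enlarged to an edge
      outside the copy.\<close>
    have "\<exists>d2\<in>D. d1 \<noteq> d2"
    proof (rule ccontr)
      assume no: "\<not> ?thesis"
      have "D - {d1} = {}"
      proof (rule ccontr)
        assume "D - {d1} \<noteq> {}"
        then obtain d where "d \<in> D" "d1 \<noteq> d" by force
        then show False using no by blast
      qed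
      then have D1: "D = {d1}" using d1 by auto
      have "2 \<le> card {u \<in> V - f ` ?P. E d1 u}" using outside[OF f(1), of d1] f(2) d1 DV by blast
      then have "0 < card {u \<in> V - f ` ?P. E d1 u}" by linarith
      then obtain y where y: "y \<in> V - f ` ?P" "E d1 y" unfolding card_gt_0_iff by blast
      have "y \<noteq> d1" using y E_irrefl by auto
      have "biconn {d1, y}"
        using conn_insert[OF conn_singleton[of d1] _ y(2)] \<open>y \<noteq> d1\<close>
        by (auto simp: biconn_def conn_singleton insert_commute insert_Diff_if)
      then show False
        using no_larger[of "{d1, y}" f] D1 y f d1 DV \<open>y \<noteq> d1\<close> by auto
    qed
    then obtain d2 where d2: "d2 \<in> D" "d1 \<noteq> d2" by blast
    define S where "S = {v \<in> V - D. 2 \<le> card {u \<in> D. E v u}}"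
    show False
    proof (cases "S = {}")
      case True
      have "D \<subset> V" using DV f(2) root_in_pos[of n k] by blast
      then obtain r0 p0 where "ear D r0 p0" using ear_exists[OF biconn _ d1 d2] by blast
      then have ex: "\<exists>p. ear D r0 p" by blast
      define r where "r = (LEAST r. \<exists>p. ear D r p)"
      obtain p where p: "ear D r p" using LeastI[of "\<lambda>r. \<exists>p. ear D r p", OF ex] by (auto simp: r_def)
      interpret shortest_ear V E col D r p
        by unfold_locales (use p in \<open>auto simp: r_def intro: Least_le\<close>)
      let ?I = "p ` {0<..<r}"
      let ?W = "V - (D \<union> ?I)"
      have IV: "?I \<subseteq> V"
      proof
        fix u assume "u \<in> ?I"
        then obtain i where "u = p i" "0 < i" "i < r" by auto
        then show "u \<in> V" using ear_props(5)[of "i - 1"] E_V[of "p (i - 1)" "p i"] by simp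
      qed
      have one: "card {u \<in> D. E v u} \<le> 1" if "v \<in> V - D" for v
        using True that unfolding S_def by force
      \<comment> \<open>At most two neighbours are lost to \<open>D\<close> and the ear, by
        \<open>card_outside_nbrs\<close>.\<close>
      have degW: "t \<le> card {u \<in> ?W. E w u}" if w: "w \<in> ?W" for w
        using card_outside_nbrs[of w] one[of w] w finD min_deg[of w]
          card_split_nbrs[of "D \<union> ?I" w] DV IV by auto
      have p1: "p 1 \<in> V - D" "p 1 \<in> ?I" using ear_props(1,6) IV by auto
      \<comment> \<open>Now \<open>?W\<close> is shown to be nonempty: in \<open>D\<close> and the
        ear, \<open>p 1\<close> has at most one neighbour in \<open>D\<close> besides
        \<open>p 2\<close>, while its degree is at least 3.\<close>
      have "{u \<in> D \<union> ?I. E (p 1) u} \<subseteq> {u \<in> D. E (p 1) u} \<union> {p 2}"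
      proof
        fix u assume u: "u \<in> {u \<in> D \<union> ?I. E (p 1) u}"
        show "u \<in> {u \<in> D. E (p 1) u} \<union> {p 2}"
        proof (cases "u \<in> D")
          case False
          then obtain j where j: "u = p j" "0 < j" "j < r" "E (p 1) (p j)" using u by auto
          have "j \<noteq> 1" using j E_irrefl by auto
          moreover have "\<not> 1 + 2 \<le> j" using no_chord[of j] j by blast
          ultimately have "j = 2" using j by linarith
          then show ?thesis using j by simp
        qed (use u in simp)
      qed
      then have "card {u \<in> D \<union> ?I. E (p 1) u} \<le> card ({u \<in> D. E (p 1) u} \<union> {p 2})"
        using finD by (intro card_mono) auto
      also have "\<dots> \<le> card {u \<in> D. E (p 1) u} + card {p 2}" by (rule card_Un_le)
      finally have "card {u \<in> D \<union> ?I. E (p 1) u} \<le> 2" using one[OF p1(1)] by simp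
      then have "1 \<le> card {u \<in> ?W. E (p 1) u}"
        using min_deg[of "p 1"] card_split_nbrs[of "D \<union> ?I" "p 1"] p1 DV IV t1 by auto
      then have "0 < card {u \<in> ?W. E (p 1) u}" by linarith
      then obtain y where y: "y \<in> ?W" unfolding card_gt_0_iff by blast
      obtain g where "embeds ?P g" "g ` ?P \<subseteq> ?W"
        using greedy_embedding[OF y degW class_le] by blast
      then show False
        using no_larger[OF biconn_add_ear[OF bD p inj_interior]] p1 DV IV by blast
    next
      case False
      have deg: "t + 1 \<le> card {u \<in> V - D. E w u}" if "w \<in> V - D" "w \<notin> S" for w
        using that min_deg[of w] card_split_nbrs[OF DV, of w] by (auto simp: S_def)
      \<comment> \<open>Two neighbours in \<open>D\<close> make \<open>v\<close> the interior of an
        ear of length 2, so with a copy avoiding \<open>v\<close> the set \<open>D\<close> could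
        grow.\<close>
      have contains: "S \<subseteq> g ` ?P" if g: "embeds ?P g" "g ` ?P \<subseteq> V - D" for g
      proof
        fix v assume v: "v \<in> S"
        show "v \<in> g ` ?P"
        proof (rule ccontr)
          assume vg: "v \<notin> g ` ?P"
          have "\<not> card {u \<in> D. E v u} \<le> Suc 0" using v by (auto simp: S_def)
          then obtain u w where uw: "u \<in> D" "w \<in> D" "E v u" "E v w" "u \<noteq> w"
            using finD by (subst (asm) card_le_Suc0_iff_eq) auto
          have vD: "v \<in> V - D" using v by (simp add: S_def)
          let ?p = "\<lambda>i::nat. if i = 0 then u else if i = 1 then v else w"
          have i2: "{0<..<2::nat} = {1}" by auto
          have "ear D 2 ?p" using uw vD E_sym by (auto simp: ear_def less_Suc_eq numeral_2_eq_2)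
          then have "biconn (D \<union> ?p ` {0<..<2::nat})"
            by (rule biconn_add_ear[OF bD]) (simp add: i2)
          then have "biconn (insert v D)" by (simp add: i2)
          then show False using no_larger[of "insert v D" g] g vD DV vg by blast
        qed
      qed
      interpret critical V E col n k "V - D" S t
        by unfold_locales (use deg class_le k_pos contains in auto)
      have "f ` ?P = V - D" by (rule critical_spanning[OF False f])
      then show False using ne DV by blast
    qed
  qed
  \<comment> \<open>A vertex of \<open>D\<close> has two neighbours outside the copy, hence in
    \<open>D\<close>.\<close>
  moreover have "3 \<le> card D"
  proof -
    obtain d where d: "d \<in> D" using bD by (auto simp: biconn_def conn_def)
    have "insert d {u \<in> D. E d u} \<subseteq> D" using d by auto
    then have "card (insert d {u \<in> D. E d u}) \<le> card D" using finD by (rule card_mono[rotated])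
    moreover have "card (insert d {u \<in> D. E d u}) = Suc (card {u \<in> D. E d u})"
      using finD E_irrefl by simp
    moreover have "2 \<le> card {u \<in> D. E d u}"
      using outside[OF f(1), of d] f(2) d DV calculation \<open>D = V - f ` ?P\<close> by auto
    ultimately show ?thesis by linarith
  qed
  ultimately show thesis using that f bD by auto
qed

end

section \<open>Coordinates of a spider and connectivity in digraph terms\<close>

lemma pos_new_leg: "pos (Suc n) (k(n := 1)) = insert (n, 1) (pos n k)"
  by (auto simp: pos_def less_Suc_eq)

lemma pos_longer_leg:
  assumes "l < n"
  shows "pos n (k(l := Suc (k l))) = insert (l, Suc (k l)) (pos n k)"
  using assms by (auto simp: pos_def le_Suc_eq split: if_splits)

context host
begin

text \<open>A largest coordinate spider centred at \<open>c\<close> spans \<open>V\<close>: an edge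
  leaving it would start a new leg, lengthen a leg, or give an inner vertex of a leg a third
  neighbour.\<close>

lemma spider_coordinates:
  assumes conn: "conn V" and c: "c \<in> V"
    and deg: "\<And>v. v \<in> V \<Longrightarrow> v \<noteq> c \<Longrightarrow> card {u \<in> V. E v u} \<le> 2"
  obtains n k h where "\<And>l. l < n \<Longrightarrow> 1 \<le> k l" "embeds (pos n k) h" "h ` pos n k = V"
proof -
  define good where "good m \<longleftrightarrow> (\<exists>n k h. (\<forall>l<n. 1 \<le> k l) \<and> embeds (pos n k) h \<and>
    h ` pos n k \<subseteq> V \<and> h (0, 0) = c \<and> card (pos n k) = m)" for m
  have emb0: "embeds (pos 0 (\<lambda>_. 1)) (\<lambda>_. c)" by (auto simp: embeds_def pos_def)
  have "good (card (pos 0 (\<lambda>_. 1)))"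
    unfolding good_def by (rule exI[of _ 0], rule exI[of _ "\<lambda>_. 1"], rule exI[of _ "\<lambda>_. c"])
      (use emb0 c in auto)
  moreover have bound: "m \<le> card V" if "good m" for m
  proof -
    from that obtain n k h where h: "embeds (pos n k) h" "h ` pos n k \<subseteq> V" "card (pos n k) = m"
      by (auto simp: good_def)
    then have "card (h ` pos n k) = m" using card_image[of h "pos n k"] by (simp add: embeds_def)
    then show ?thesis using card_mono[OF finite_V h(2)] by simp
  qed
  ultimately obtain m where m: "good m" and max: "\<And>m'. good m' \<Longrightarrow> m' \<le> m"
    using Nat.ex_has_greatest_nat[of good _ "card V"] by metis
  obtain n k h where h: "\<And>l. l < n \<Longrightarrow> 1 \<le> k l" "embeds (pos n k) h"
    "h ` pos n k \<subseteq> V" "h (0, 0) = c" "card (pos n k) = m"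
    using m unfolding good_def by blast
  have no_extension: False
    if "q \<notin> pos n k" "pos n' k' = insert q (pos n k)" "par q \<in> pos n k" "E (h (par q)) y"
      "y \<notin> h ` pos n k" "\<And>l. l < n' \<Longrightarrow> 1 \<le> k' l" for q n' k' y
  proof -
    have "embeds (pos n' k') (h(q := y))"
      unfolding that(2) by (rule embeds_insert[OF par_closed_pos h(2) that(1,3,5,4)])
    moreover have "(h(q := y)) ` pos n' k' \<subseteq> V"
      unfolding that(2) using h(3) E_V[OF that(4)] by auto
    moreover have "(h(q := y)) (0, 0) = c" using h(4) that(1) root_in_pos by auto
    moreover have "card (pos n' k') = Suc m" unfolding that(2) using that(1) h(5) finite_pos by simp
    ultimately have "good (Suc m)" unfolding good_def using that(6) by blast
    then show False using max by fastforce
  qed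
  have "h ` pos n k = V"
  proof (rule ccontr)
    assume "h ` pos n k \<noteq> V"
    then obtain y0 where y0: "y0 \<in> V" "y0 \<notin> h ` pos n k" using h(3) by blast
    have "h (0,0) \<in> h ` pos n k" by (intro imageI root_in_pos)
    then have "c \<in> h ` pos n k" using h(4) by simp
    moreover have "(c, y0) \<in> (step V)\<^sup>*" using conn c y0 by (simp add: conn_def)
    ultimately obtain x y where xy: "x \<in> h ` pos n k" "y \<notin> h ` pos n k" "y \<in> V" "E x y"
      using exit_edge y0(2) by metis
    obtain q where q: "q \<in> pos n k" "x = h q" using xy(1) by blast
    show False
    proof (cases "q = (0, 0)")
      case True
      show False
      proof (rule no_extension[OF _ pos_new_leg[of n k]])
        show "(n, 1) \<notin> pos n k" by (simp add: pos_def)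
        show "par (n, 1) \<in> pos n k" "E (h (par (n, 1))) y" using True q xy(4) by (simp_all add: par_def)
        show "y \<notin> h ` pos n k" by fact
        show "1 \<le> (k(n := 1)) l" if "l < Suc n" for l using that h(1) by (auto simp: less_Suc_eq)
      qed
    next
      case False
      then obtain l p where lp: "q = (l, p)" "l < n" "1 \<le> p" "p \<le> k l" using q by (auto simp: pos_def)
      show False
      proof (cases "p = k l")
        case True
        show False
        proof (rule no_extension[OF _ pos_longer_leg[OF lp(2), of k]])
          have "par (l, Suc (k l)) = q" using True lp by (simp add: par_def)
          then show "par (l, Suc (k l)) \<in> pos n k" "E (h (par (l, Suc (k l)))) y" using q xy(4) by auto
          show "(l, Suc (k l)) \<notin> pos n k" by (simp add: pos_def)
          show "y \<notin> h ` pos n k" by fact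
          show "1 \<le> (k(l := Suc (k l))) l'" if "l' < n" for l' using that h(1) by auto
        qed
      next
        case False
        let ?s = "(l, Suc p)"
        have s: "?s \<in> pos n k" "par ?s = q" "?s \<noteq> (0,0)" using False lp by (auto simp: pos_def par_def)
        have pq: "par q \<in> pos n k" using q par_closed_pos by (auto simp: par_closed_def)
        have inj: "inj_on h (pos n k)" using h(2) by (simp add: embeds_def)
        have "par q \<noteq> ?s" using lp by (auto simp: par_def)
        then have "h (par q) \<noteq> h ?s" using inj_onD[OF inj _ pq s(1)] by blast
        moreover have "y \<noteq> h (par q)" "y \<noteq> h ?s" using xy(2) pq s(1) by auto
        ultimately have c3: "card {h (par q), h ?s, y} = 3" by auto
        have "E (h (par q)) (h q)" using h(2) q \<open>q \<noteq> (0,0)\<close> by (auto simp: embeds_def)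
        moreover have "E (h q) (h ?s)" using h(2) s by (fastforce simp: embeds_def)
        ultimately have "{h (par q), h ?s, y} \<subseteq> {u \<in> V. E x u}"
          using E_sym q(2) xy h(3) pq s(1) by auto
        then have "3 \<le> card {u \<in> V. E x u}" using c3 finite_V by (metis (no_types, lifting) card_mono finite_Collect_conjI finite_subset mem_Collect_eq subsetI)
        moreover have "x \<noteq> c"
          using inj_onD[OF inj _ q(1) root_in_pos] q(2) h(4) \<open>q \<noteq> (0,0)\<close> by auto
        moreover have "x \<in> V" using xy(1) h(3) by blast
        ultimately show False using deg[of x] by linarith
      qed
    qed
  qed
  then show thesis using that h(1,2) by blast
qed

end

section \<open>Digraphs as instances of \<open>host\<close>, and 2-connectivity\<close>

lemma graph_symD: "graph G \<Longrightarrow> u \<rightarrow>\<^bsub>G\<^esub> v \<Longrightarrow> v \<rightarrow>\<^bsub>G\<^esub> u"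
  using sym_digraph.sym_arcs[of G] arcs_ends_symmetric[of G u v]
  by (auto simp: graph_def pseudo_graph_def)

lemma host_graph:
  assumes "graph G" "bipartition G X Y"
  shows "host (verts G) (dominates G) (\<lambda>v. v \<in> X)"
proof -
  interpret graph G by fact
  show ?thesis
  proof
    fix u v assume e: "u \<rightarrow>\<^bsub>G\<^esub> v"
    show "v \<in> verts G" "v \<rightarrow>\<^bsub>G\<^esub> u" using adj_in_verts[OF e] graph_symD[OF assms(1) e] by auto
    have "u \<in> X \<union> Y" "v \<in> X \<union> Y" using adj_in_verts[OF e] assms(2) by (auto simp: bipartition_def)
    then show "(u \<in> X) \<noteq> (v \<in> X)"
      using e assms(2) unfolding bipartition_def independent_set_def by blast
  qed simp
qed

lemma out_degree_card:
  assumes "graph G"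
  shows "out_degree G v = card {u \<in> verts G. v \<rightarrow>\<^bsub>G\<^esub> u}"
proof -
  interpret graph G by fact
  have "inj_on (head G) (out_arcs G v)"
    using no_multi_arcs by (auto simp: inj_on_def arc_to_ends_def)
  moreover have "head G ` out_arcs G v = {u \<in> verts G. v \<rightarrow>\<^bsub>G\<^esub> u}"
    by (auto simp: arcs_ends_conv)
  ultimately show ?thesis unfolding out_degree_def using card_image by metis
qed

text \<open>The arcs of the induced subgraph form \<open>step A\<close>, which equals its symmetric
  closure.\<close>

lemma connected_induced:
  assumes "graph G" "bipartition G X Y" "A \<subseteq> verts G"
  shows "Digraph_Component.connected (G \<restriction> A) \<longleftrightarrow> host.conn (dominates G) A"
proof -
  interpret graph G by fact
  interpret host "verts G" "dominates G" "\<lambda>v. v \<in> X" using assms by (intro host_graph)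
  have "arcs_ends (G \<restriction> A) = step A"
    unfolding step_def by (auto simp: arcs_ends_conv)
  moreover have "symcl (step A) = step A"
    using E_sym by (auto simp: symcl_def step_def)
  ultimately have "symcl (arcs_ends (G \<restriction> A)) = step A" by simp
  moreover have "(u, v) \<in> rtrancl_on A (step A) \<longleftrightarrow> (u, v) \<in> (step A)\<^sup>*" if "u \<in> A" for u v
  proof
    assume "(u, v) \<in> (step A)\<^sup>*"
    then show "(u, v) \<in> rtrancl_on A (step A)"
      using that by induction (auto simp: step_def intro: rtrancl_on_into_rtrancl_on)
  qed (rule rtrancl_on_rtranclI)
  ultimately show ?thesis unfolding connected_conv conn_def by simp
qed

text \<open>Only the empty set and single vertices have to be excluded as deleted sets. That
  deleting them never leaves exactly one vertex amounts to \<open>3 \<le> card A\<close>.\<close>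

lemma k_connected_2_iff:
  assumes "graph G" "bipartition G X Y" "A \<subseteq> verts G"
  shows "k_connected 2 (G \<restriction> A) \<longleftrightarrow> host.biconn (dominates G) A \<and> 3 \<le> card A"
proof -
  interpret graph G by fact
  interpret host "verts G" "dominates G" "\<lambda>v. v \<in> X" using assms by (intro host_graph)
  have finA: "finite A" using assms(3) finite_V finite_subset by blast
  have del: "delete_verts (G \<restriction> A) S = G \<restriction> (A - S)" for S
    by (auto simp: delete_verts_def induce_subgraph_def)
  define sep where "sep S \<longleftrightarrow> S \<subseteq> A \<and> (\<not> conn (A - S) \<or> card (A - S) = 1)" for S
  have K: "{card S | S. S \<subseteq> verts (G \<restriction> A) \<and>
     (\<not> Digraph_Component.connected (delete_verts (G \<restriction> A) S) \<or> card (verts (delete_verts (G \<restriction> A) S)) = 1)}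
     = card ` {S. sep S}"
  proof -
    have "Digraph_Component.connected (G \<restriction> (A - S)) \<longleftrightarrow> conn (A - S)" for S
      using assms(3) by (intro connected_induced[OF assms(1,2)]) auto
    then show ?thesis unfolding sep_def image_Collect by (simp add: del)
  qed
  have fin: "finite (card ` {S. sep S})"
    by (rule finite_imageI, rule finite_subset[of _ "Pow A"]) (auto simp: sep_def finA)
  \<comment> \<open>The empty remainder is not connected, so the minimum is taken over a nonempty
    set.\<close>
  have "sep A" by (auto simp: sep_def conn_def)
  then have ne: "card ` {S. sep S} \<noteq> {}" by blast
  have "k_connected 2 (G \<restriction> A) \<longleftrightarrow> (\<forall>S. sep S \<longrightarrow> 2 \<le> card S)"
    unfolding k_connected_def connectivity_def K Min_ge_iff[OF fin ne] by blast
  also have "\<dots> \<longleftrightarrow> biconn A \<and> 3 \<le> card A"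
  proof
    assume L: "\<forall>S. sep S \<longrightarrow> 2 \<le> card S"
    have "\<not> sep {}" using L by fastforce
    then have A0: "conn A" "card A \<noteq> 1" by (auto simp: sep_def)
    have A1: "conn (A - {v})" "card (A - {v}) \<noteq> 1" if "v \<in> A" for v
    proof -
      have "\<not> sep {v}" using L by fastforce
      then show "conn (A - {v})" "card (A - {v}) \<noteq> 1" using that by (auto simp: sep_def)
    qed
    obtain v where v: "v \<in> A" using A0(1) by (auto simp: conn_def)
    have "card (A - {v}) = card A - 1" using v by simp
    moreover have "card A \<noteq> 0" using v finA by auto
    ultimately have "3 \<le> card A" using A0(2) A1(2)[OF v] by linarith
    then show "biconn A \<and> 3 \<le> card A" using A0 A1 by (auto simp: biconn_def)
  next
    assume R: "biconn A \<and> 3 \<le> card A"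
    show "\<forall>S. sep S \<longrightarrow> 2 \<le> card S"
    proof (intro allI impI)
      fix S assume S: "sep S"
      have finS: "finite S" using S finA finite_subset by (auto simp: sep_def)
      show "2 \<le> card S"
      proof (rule ccontr)
        assume "\<not> 2 \<le> card S"
        then have "card S = 0 \<or> card S = 1" by linarith
        then show False
        proof
          assume "card S = 0"
          then have "S = {}" using finS by simp
          then show False using S R by (auto simp: sep_def biconn_def)
        next
          assume "card S = 1"
          then obtain v where v: "S = {v}" by (auto simp: card_1_singleton_iff)
          have vA: "v \<in> A" using S v by (simp add: sep_def)
          have "card (A - {v}) = card A - 1" using vA by simp
          moreover have "A \<noteq> {v}" using R by auto
          ultimately show False using S v R vA by (auto simp: sep_def biconn_def)
        qed
      qed
    qed
  qed
  finally show ?thesis .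
qed

section \<open>Copies of a spider as subgraphs\<close>

lemma (in wf_digraph) cycle_app_iso:
  assumes hom: "digraph_isomorphism hom" and c: "cycle p"
  shows "pre_digraph.cycle (app_iso hom G) (map (iso_arcs hom) p)"
proof -
  obtain u where u: "awalk u p u" "distinct (tl (awalk_verts u p))" "p \<noteq> []"
    using c by (auto simp: cycle_def)
  have "set (tl (awalk_verts u p)) \<subseteq> verts G"
    using u(1) list.set_sel(2)[OF awalk_verts_non_Nil, of _ u p] by auto
  then have "distinct (map (iso_verts hom) (tl (awalk_verts u p)))"
    using u(2) digraph_isomorphism_inj_on_verts[OF hom] inj_on_subset
    by (auto simp: distinct_map)
  then show ?thesis
    using awalk_app_isoI[OF u(1) hom] awalk_verts_app_iso_eq[OF hom u(1)] u(3)
    unfolding pre_digraph.cycle_def by (auto simp: map_tl)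
qed

text \<open>Cycles are pulled back along the inverse isomorphism; branching vertices are carried
  along \<open>hom\<close>.\<close>

lemma spider_iso:
  assumes T: "spider T" and iso: "digraph_iso T T'" and T': "graph T'"
  shows "spider T'"
proof -
  interpret graph T using T by (simp add: spider_def undirected_tree_def)
  interpret T': graph T' by fact
  obtain hom where hom: "digraph_isomorphism hom" "T' = app_iso hom T"
    using iso by (auto simp: digraph_iso_def)
  have inv: "T'.digraph_isomorphism (inv_iso hom)" "app_iso (inv_iso hom) T' = T"
    using digraph_isomorphism_invI[OF hom(1)] app_iso_inv[OF hom(1)] hom(2) by auto
  have "Digraph_Component.connected T'"
    using connectedI_app_iso[OF _ hom(1)] T hom(2) by (simp add: spider_def undirected_tree_def)
  moreover have "\<not> (\<exists>p. T'.cycle p \<and> 3 \<le> length p)"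
  proof
    assume "\<exists>p. T'.cycle p \<and> 3 \<le> length p"
    then obtain p where p: "T'.cycle p" "3 \<le> length p" by blast
    then have "cycle (map (iso_arcs (inv_iso hom)) p)"
      using T'.cycle_app_iso[OF inv(1) p(1)] inv(2) by simp
    then show False using T p(2) by (auto simp: spider_def undirected_tree_def)
  qed
  moreover have "card {v \<in> verts T'. 2 < out_degree T' v} \<le> 1"
  proof -
    have "{v \<in> verts T'. 2 < out_degree T' v} = iso_verts hom ` {v \<in> verts T. 2 < out_degree T v}"
      using hom(2) out_degree_app_iso_eq[OF hom(1)] by auto
    then have "card {v \<in> verts T'. 2 < out_degree T' v} \<le> card {v \<in> verts T. 2 < out_degree T v}"
      by (simp add: card_image_le)
    then show ?thesis using T by (simp add: spider_def)
  qed
  ultimately show ?thesis using T' by (simp add: spider_def undirected_tree_def)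
qed

lemma subgraph_of_embedding:
  assumes T: "graph T" and G: "graph G" and inj: "inj_on g (verts T)" and V: "g ` verts T \<subseteq> verts G"
    and hom: "\<And>u v. u \<rightarrow>\<^bsub>T\<^esub> v \<Longrightarrow> g u \<rightarrow>\<^bsub>G\<^esub> g v"
  obtains T' where "subgraph T' G" "graph T'" "verts T' = g ` verts T" "digraph_iso T T'"
proof -
  interpret T: graph T by fact
  interpret G: graph G by fact
  have "\<exists>e\<in>arcs G. tail G e = g (tail T a) \<and> head G e = g (head T a)" if "a \<in> arcs T" for a
    using hom[of "tail T a" "head T a"] that by (auto simp: arcs_ends_conv)
  then obtain h where h: "\<And>a. a \<in> arcs T \<Longrightarrow> h a \<in> arcs G"
    "\<And>a. a \<in> arcs T \<Longrightarrow> tail G (h a) = g (tail T a)"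
    "\<And>a. a \<in> arcs T \<Longrightarrow> head G (h a) = g (head T a)" by metis
  \<comment> \<open>With tail and head taken from \<open>G\<close>, the image of \<open>T\<close>
    under \<open>f\<close> becomes a subgraph of \<open>G\<close>.\<close>
  define f where "f = \<lparr>iso_verts = g, iso_arcs = h, iso_head = head G, iso_tail = tail G\<rparr>"
  have "inj_on h (arcs T)"
  proof (rule inj_onI)
    fix a b assume ab: "a \<in> arcs T" "b \<in> arcs T" "h a = h b"
    then have "g (tail T a) = g (tail T b)" "g (head T a) = g (head T b)" using h by metis+
    then have "tail T a = tail T b" "head T a = head T b"
      using inj_onD[OF inj] ab by auto
    then show "a = b" using T.no_multi_arcs[OF ab(1,2)] by (simp add: arc_to_ends_def)
  qed
  then have f: "T.digraph_isomorphism f"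
    using inj h T.wf_digraph by (simp add: T.digraph_isomorphism_def f_def)
  let ?T' = "app_iso f T"
  have wf: "wf_digraph ?T'" using f by (rule T.wf_digraphI_app_iso)
  have sub: "subgraph ?T' G"
    using V h wf G.wf_digraph by (auto simp: subgraph_def compatible_def f_def)
  interpret T': digraph ?T' using sub by (rule G.digraph_subgraph)
  have "symmetric ?T'"
    using graph_symD[OF T] T.arcs_ends_app_iso_eq[OF f]
    by (auto simp: symmetric_def sym_def)
  then have "graph ?T'" by (rule T'.graphI)
  moreover have "digraph_iso T ?T'" using f by (auto simp: digraph_iso_def)
  moreover have "verts ?T' = g ` verts T" by (simp add: f_def)
  ultimately show thesis using that sub by blast
qed

text \<open>A path from \<open>u\<close> to \<open>v\<close> without the edge between them has at
  least two arcs; the arc from \<open>v\<close> to \<open>u\<close> closes it.\<close>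

lemma long_cycle_from_detour:
  assumes T: "graph T" and e: "v \<rightarrow>\<^bsub>T\<^esub> u"
    and detour: "(u, v) \<in> (arcs_ends T - {(u, v), (v, u)})\<^sup>*"
  shows "\<exists>p. pre_digraph.cycle T p \<and> 3 \<le> length p"
proof -
  interpret T: graph T by fact
  define H where "H = T\<lparr>arcs := {a \<in> arcs T. (tail T a, head T a) \<notin> {(u, v), (v, u)}}\<rparr>"
  have H: "verts H = verts T" "tail H = tail T" "head H = head T"
    "arcs H = {a \<in> arcs T. (tail T a, head T a) \<notin> {(u, v), (v, u)}}"
    by (simp_all add: H_def)
  interpret H: wf_digraph H by unfold_locales (auto simp: H)
  have sub: "subgraph H T" by (rule subgraphI) (auto simp: H compatible_def T.wf_digraph H.wf_digraph)
  have "arcs_ends H = arcs_ends T - {(u, v), (v, u)}"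
    by (auto simp: arcs_ends_conv H)
  then have "u \<rightarrow>\<^sup>*\<^bsub>H\<^esub> v"
    using detour T.adj_in_verts(2)[OF e] by (subst H.reachable_conv') (simp_all add: H)
  then obtain p where p: "H.apath u p v" by (auto simp: H.reachable_apath)
  have neq: "u \<noteq> v" using e T.adj_not_same by auto
  have "p \<noteq> []" using p neq by (auto simp: H.apath_Nil_iff)
  moreover have "\<exists>a. p = [a] \<Longrightarrow> False" using p by (auto simp: H.apath_simps H)
  ultimately have len: "2 \<le> length p" by (cases p; cases "tl p") auto
  have pT: "T.apath u p v" using T.subgraph_apath_imp_apath[OF p sub] .
  obtain a where a: "a \<in> arcs T" "tail T a = v" "head T a = u" using e by (auto simp: arcs_ends_conv)
  have "T.cycle (a # p)"
    unfolding T.cycle_def using pT a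
    by (intro exI[of _ v]) (auto simp: T.apath_def T.awalk_Cons_iff)
  then show ?thesis using len by (intro exI[of _ "a # p"]) simp
qed

text \<open>\<open>embeds\<close> only provides the edges to parents. A further edge could be
  bypassed through the centre, giving a long cycle. Hence respecting the edges to parents suffices
  for respecting all edges of \<open>T\<close>.\<close>

lemma tree_arcs:
  assumes T: "undirected_tree T" and bip: "bipartition T X Y"
    and h: "host.embeds (dominates T) (pos n k) h" "h ` pos n k = verts T"
    and e: "h p \<rightarrow>\<^bsub>T\<^esub> h q" and pq: "p \<in> pos n k" "q \<in> pos n k"
  shows "p \<noteq> (0, 0) \<and> q = par p \<or> q \<noteq> (0, 0) \<and> p = par q"
proof (rule ccontr)
  assume no: "\<not> ?thesis"
  have gT: "graph T" using T by (simp add: undirected_tree_def)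
  interpret host "verts T" "dominates T" "\<lambda>v. v \<in> X" using host_graph[OF gT bip] .
  let ?R = "arcs_ends T - {(h q, h p), (h p, h q)}"
  have inj: "inj_on h (pos n k)" using h(1) by (simp add: embeds_def)
  have tree_edge: "(h (par x), h x) \<in> ?R" "(h x, h (par x)) \<in> ?R" if x: "x \<in> pos n k" "x \<noteq> (0,0)" for x
  proof -
    have par: "par x \<in> pos n k" using x par_closed_pos by (auto simp: par_closed_def)
    have E: "h (par x) \<rightarrow>\<^bsub>T\<^esub> h x" using h(1) x by (auto simp: embeds_def)
    have "\<not> (h (par x) = h q \<and> h x = h p)" "\<not> (h (par x) = h p \<and> h x = h q)"
      using no x par pq inj_onD[OF inj] by metis+
    then show "(h (par x), h x) \<in> ?R" "(h x, h (par x)) \<in> ?R" using E E_sym[OF E] by auto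
  qed
  have root: "(h x, h (0, 0)) \<in> ?R\<^sup>* \<and> (h (0, 0), h x) \<in> ?R\<^sup>*" if "x \<in> pos n k" for x
    using that
  proof (induction "snd x" arbitrary: x rule: less_induct)
    case less
    show ?case
    proof (cases "x = (0, 0)")
      case False
      have "par x \<in> pos n k" using less.prems par_closed_pos by (auto simp: par_closed_def)
      moreover have "snd (par x) < snd x" using snd_par[OF less.prems False] by simp
      ultimately have IH: "(h (par x), h (0, 0)) \<in> ?R\<^sup>*" "(h (0, 0), h (par x)) \<in> ?R\<^sup>*"
        using less.hyps by blast+
      show ?thesis
        using converse_rtrancl_into_rtrancl[OF tree_edge(2)[OF less.prems False] IH(1)]
          rtrancl_into_rtrancl[OF IH(2) tree_edge(1)[OF less.prems False]] by simp
    qed simp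
  qed
  have "(h q, h p) \<in> ?R\<^sup>*" using root[OF pq(1)] root[OF pq(2)] rtrancl_trans by metis
  then have "\<exists>c. pre_digraph.cycle T c \<and> 3 \<le> length c"
    by (rule long_cycle_from_detour[OF gT e])
  then show False using T by (simp add: undirected_tree_def)
qed

text \<open>The injection \<open>h\<close> maps a parity class into \<open>X\<close> or into
  \<open>Y\<close>.\<close>

lemma coordinate_class_le:
  assumes T: "graph T" and bip: "bipartition T X Y"
    and h: "host.embeds (dominates T) (pos n k) h" "h ` pos n k = verts T"
  shows "card {q \<in> pos n k. even (snd q) \<longleftrightarrow> b} \<le> max (card X) (card Y)"
proof -
  interpret graph T by fact
  interpret spider_host "verts T" "dominates T" "\<lambda>v. v \<in> X" n k
    using host_graph[OF T bip] by (simp add: spider_host_def)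
  have inj: "inj_on h (pos n k)" using h(1) by (simp add: embeds_def)
  have XY: "X \<union> Y = verts T" "X \<inter> Y = {}" using bip by (auto simp: bipartition_def)
  then have fin: "finite X" "finite Y" using finite_verts by (metis finite_Un)+
  let ?C = "{q \<in> pos n k. even (snd q) \<longleftrightarrow> b}"
  have col: "h q \<in> X \<longleftrightarrow> (h (0, 0) \<in> X \<longleftrightarrow> b)" if "q \<in> ?C" for q
    using embeds_col[OF par_closed_pos order_refl h(1), of q] that by auto
  have "card ?C = card (h ` ?C)" by (rule card_image[symmetric], rule inj_on_subset[OF inj]) auto
  also have "\<dots> \<le> max (card X) (card Y)"
  proof (cases "h (0, 0) \<in> X \<longleftrightarrow> b")
    case True
    then have "h ` ?C \<subseteq> X" using col by blast
    from card_mono[OF fin(1) this] show ?thesis by (rule max.coboundedI1)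
  next
    case False
    then have "h ` ?C \<subseteq> Y" using col h(2) XY by blast
    from card_mono[OF fin(2) this] show ?thesis by (rule max.coboundedI2)
  qed
  finally show ?thesis .
qed

lemma spider_graph_coordinates:
  assumes T: "spider T" and bip: "bipartition T X Y"
  obtains n k h where "\<And>l. l < n \<Longrightarrow> 1 \<le> k l" "host.embeds (dominates T) (pos n k) h"
    "h ` pos n k = verts T"
proof -
  have gT: "graph T" and cT: "Digraph_Component.connected T" using T by (auto simp: spider_def undirected_tree_def)
  interpret graph T by fact
  interpret host "verts T" "dominates T" "\<lambda>v. v \<in> X" using host_graph[OF gT bip] .
  have "T \<restriction> verts T = T" by (auto simp: induce_subgraph_def intro!: pre_digraph.equality)
  then have conn: "conn (verts T)" using connected_induced[OF gT bip order_refl] cT by simp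
  let ?B = "{v \<in> verts T. 2 < out_degree T v}"
  have B: "\<And>u v. u \<in> ?B \<Longrightarrow> v \<in> ?B \<Longrightarrow> u = v"
    using T card_le_Suc0_iff_eq[of ?B] by (auto simp: spider_def)
  \<comment> \<open>The centre is the branching vertex or, if there is none, any vertex.\<close>
  obtain c where c: "c \<in> verts T" "?B \<subseteq> {c}"
  proof (cases "?B = {}")
    case True
    obtain c where "c \<in> verts T" using conn by (auto simp: conn_def)
    then show ?thesis using that[of c] True by simp
  next
    case False
    then obtain c where "c \<in> ?B" by blast
    then show ?thesis using that[of c] B by blast
  qed
  have "card {u \<in> verts T. v \<rightarrow>\<^bsub>T\<^esub> u} \<le> 2" if "v \<in> verts T" "v \<noteq> c" for v
    using that c(2) out_degree_card[OF gT, of v] by auto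
  then show thesis using spider_coordinates[OF conn c(1)] that by blast
qed

theorem theorem4p1:
  fixes T :: "('a, 'b) pre_digraph" and G :: "('c, 'd) pre_digraph"
    and X Y :: "'a set" and t :: nat
  assumes "spider T"
    and "bipartition T X Y"
    and "t = max (card X) (card Y)"
    and "graph G"
    and "k_connected 2 G"
    and "bipartite G"
    and "min_degree G \<ge> t + 2"
  shows "\<exists>T'. subgraph T' G \<and> spider T' \<and> digraph_iso T T' \<and>
           k_connected 2 (delete_verts G (verts T'))"
proof -
  have tT: "undirected_tree T" and gT: "graph T"
    using assms(1) by (auto simp: spider_def undirected_tree_def)
  obtain n k h where k: "\<And>l. l < n \<Longrightarrow> 1 \<le> k l" and h: "host.embeds (dominates T) (pos n k) h"
    "h ` pos n k = verts T"
    by (rule spider_graph_coordinates[OF assms(1,2)]) blast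
  interpret HT: host "verts T" "dominates T" "\<lambda>v. v \<in> X" using host_graph[OF gT assms(2)] .
  obtain A B where AB: "bipartition G A B" using assms(6) by (auto simp: bipartite_def)
  interpret G: graph G by fact
  interpret HG: spider_host "verts G" "dominates G" "\<lambda>v. v \<in> A" n k
    using host_graph[OF assms(4) AB] by (simp add: spider_host_def)
  have "G \<restriction> verts G = G" by (auto simp: induce_subgraph_def intro!: pre_digraph.equality)
  then have bi: "HG.biconn (verts G)"
    using k_connected_2_iff[OF assms(4) AB order_refl] assms(5) by simp
  have deg: "t + 2 \<le> card {u \<in> verts G. v \<rightarrow>\<^bsub>G\<^esub> u}" if v: "v \<in> verts G" for v
  proof -
    have "min_degree G \<le> out_degree G v" unfolding min_degree_def using v by (intro Min_le) auto
    then show ?thesis using assms(7) out_degree_card[OF assms(4), of v] by linarith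
  qed
  have cls: "card {q \<in> pos n k. even (snd q) \<longleftrightarrow> b} \<le> t" for b
    using coordinate_class_le[OF gT assms(2) h] assms(3) by simp
  obtain f where f: "HG.embeds (pos n k) f" "f ` pos n k \<subseteq> verts G"
    "HG.biconn (verts G - f ` pos n k)" "3 \<le> card (verts G - f ` pos n k)"
    by (rule HG.nonseparating_embedding[OF bi deg cls k])
  \<comment> \<open>Passing through the coordinates turns the embedding of positions into one of
    \<open>T\<close>.\<close>
  define g where "g = f \<circ> inv_into (pos n k) h"
  have injh: "inj_on h (pos n k)" and injf: "inj_on f (pos n k)"
    using h(1) f(1) by (auto simp: HT.embeds_def HG.embeds_def)
  have gh: "g (h q) = f q" if "q \<in> pos n k" for q using that injh by (simp add: g_def)
  have g_img: "g ` verts T = f ` pos n k"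
    unfolding h(2)[symmetric] image_image using gh by (intro image_cong) auto
  have g_inj: "inj_on g (verts T)"
    unfolding h(2)[symmetric] using gh injf by (auto simp: inj_on_def)
  have g_hom: "g u \<rightarrow>\<^bsub>G\<^esub> g v" if uv: "u \<rightarrow>\<^bsub>T\<^esub> v" for u v
  proof -
    have "u \<in> verts T" "v \<in> verts T" using HT.E_V[OF uv] HT.E_V[OF HT.E_sym[OF uv]] by auto
    then obtain p q where pq: "p \<in> pos n k" "q \<in> pos n k" "u = h p" "v = h q"
      using h(2) by blast
    from tree_arcs[OF tT assms(2) h _ pq(1,2)] uv pq
    have "p \<noteq> (0, 0) \<and> q = par p \<or> q \<noteq> (0, 0) \<and> p = par q" by simp
    then have "f p \<rightarrow>\<^bsub>G\<^esub> f q"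
      using f(1) pq(1,2) HG.E_sym unfolding HG.embeds_def by blast
    then show ?thesis using pq gh by simp
  qed
  obtain T' where T': "subgraph T' G" "graph T'" "verts T' = g ` verts T" "digraph_iso T T'"
    using subgraph_of_embedding[OF gT assms(4) g_inj _ g_hom] g_img f(2) by auto
  have "k_connected 2 (delete_verts G (verts T'))"
    unfolding delete_verts_def T'(3) g_img
    using k_connected_2_iff[OF assms(4) AB, of "verts G - f ` pos n k"] f(3,4) by auto
  then show ?thesis using T' spider_iso[OF assms(1) T'(4,2)] by blast
qed

end
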